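(* Let $\rho$ be the rank $2$ Drinfeld $\mathbb{F}_q[t]$-module given by $\rho_t=\theta+\kappa\tau+\Delta\tau^2$ with $\kappa,\Delta\in\bar{k}$, $\Delta\neq 0$, and fix a $(q-1)$-st root $\sqrt[q-1]{-\Delta}$ of $-\Delta$. Let $\alpha\in\bar{k}^{\times}$ and let $\phi$ be the two-dimensional $t$-module defined by $$\phi_t=\begin{pmatrix}\rho_t & 0\\ \alpha\tau & C_t\end{pmatrix},\qquad C_t=\theta+\tau .$$ Let $u\in\mathbb{C}_\infty$ satisfy $\exp_\rho(u)=\alpha/\sqrt[q-1]{-\Delta}$. Then for every period vector $(\omega,\lambda)^{\mathrm{tr}}\in\operatorname{Ker}\exp_\phi$ (with $\omega,\lambda\in\mathbb{C}_\infty$) there exists $f\in\mathbb{F}_q[t]$ such that $$\lambda=-\sqrt[q-1]{-\Delta}\,\bigl(uF_\tau(\omega)-\omega F_\tau(u)\bigr)+f(\theta)\,\tilde{\pi}.$$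
   Context: $\mathbb{F}_q$ is the finite field with $q$ elements ($q$ a power of a prime $p$), $k=\mathbb{F}_q(\theta)$, $\mathbb{C}_\infty$ is the completion of an algebraic closure of $\mathbb{F}_q((1/\theta))$ with $|\theta|_\infty=q$, and $\bar{k}$ is the algebraic closure of $k$ in $\mathbb{C}_\infty$. $\tau$ is the $q$-th power Frobenius, and $\mathbb{C}_\infty[\tau]$ is the twisted polynomial ring with $\tau c=c^q\tau$; matrices over $\mathbb{C}_\infty[\tau]$ act on vectors in $\mathbb{C}_\infty^2$ with $\tau$ acting coordinatewise by $x\mapsto x^q$. The exponential $\exp_\rho$ of $\rho$ is the unique power series $z+\sum_{i\ge1}a_iz^{q^i}$ with $\exp_\rho(\theta z)=\rho_t(\exp_\rho(z))$; its kernel $\Lambda_\rho$ is the period lattice. The quasi-periodic function $F_\tau$ of $\rho$ is the unique power series with $F_\tau(z)\equiv 0\pmod{z^q}$ and $F_\tau(\theta z)-\theta F_\tau(z)=\exp_\rho(z)^q$; it is entire. $C$ is the Carlitz module $C_t=\theta+\tau$ and $\tilde{\pi}$ is a generator of its period lattice (the kernel of its exponential) over $\mathbb{F}_q[\theta]$. The exponential $\exp_\phi$ of $\phi$ is the unique entire $\mathbb{F}_q$-linear map $\mathbb{C}_\infty^2\to\mathbb{C}_\infty^2$ with $\exp_\phi(\mathbf{z})\equiv\mathbf{z}$ modulo terms of degree $\ge q$ and $\exp_\phi(\theta\mathbf{z})=\phi_t(\exp_\phi(\mathbf{z}))$. *)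

theory Defs
  imports "HOL-Analysis.Analysis" "HOL-Computational_Algebra.Computational_Algebra"
begin

(* The real-normed classes of HOL-Analysis force characteristic 0, so they cannot be used for
   C_infinity.  Positivity, definiteness and completeness of the absolute value are inherited
   from complete_space through absval_dist, and the topology is the one it defines. *)
class complete_alg_closed_valued_field = alg_closed_field + complete_space +
  fixes absval :: "'a \<Rightarrow> real"
  assumes absval_dist: "dist x y = absval (x - y)"
    and absval_mult: "absval (x * y) = absval x * absval y"
    and absval_ultrametric: "absval (x + y) \<le> max (absval x) (absval y)"

definition subfield_set :: "'a::field set \<Rightarrow> bool" where
  "subfield_set S \<longleftrightarrow> 0 \<in> S \<and> 1 \<in> S \<and>
     (\<forall>x\<in>S. \<forall>y\<in>S. x + y \<in> S \<and> x * y \<in> S) \<and> (\<forall>x\<in>S. - x \<in> S \<and> inverse x \<in> S)"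

definition polys_over :: "'a::zero set \<Rightarrow> 'a poly set" where
  "polys_over S = {p. \<forall>i. coeff p i \<in> S}"

definition algebraic_over :: "'a::field set \<Rightarrow> 'a set" where
  "algebraic_over S = {x. \<exists>p\<in>polys_over S. p \<noteq> 0 \<and> poly p x = 0}"

definition rational_field :: "'a::field set \<Rightarrow> 'a \<Rightarrow> 'a set" where
  "rational_field F \<theta> =
     {poly a \<theta> / poly b \<theta> | a b. a \<in> polys_over F \<and> b \<in> polys_over F \<and> poly b \<theta> \<noteq> 0}"

definition laurent_field :: "'a::complete_alg_closed_valued_field set \<Rightarrow> 'a \<Rightarrow> 'a set" where
  "laurent_field F \<theta> = {x. \<exists>N c. range c \<subseteq> F \<and> (\<lambda>n. c n * (\<theta> ^ N / \<theta> ^ n)) sums x}"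

(* The type 'a is C_infinity and F is its subfield with q elements.  Since 'a is algebraically
   closed, the elements algebraic over F((1/theta)) form an algebraic closure of it; since 'a is
   complete, density of this set says that 'a is its completion.  The absolute value is
   determined by |theta| = q, because elements of the finite field have absolute value 0 or 1. *)
locale C_infinity =
  fixes q :: nat and F :: "'a::complete_alg_closed_valued_field set" and \<theta> :: 'a
  assumes finite_F: "finite F"
    and subfield_F: "subfield_set F"
    and card_F: "card F = q"
    and absval_theta: "absval \<theta> = real q"
    and dense_algebraic: "closure (algebraic_over (laurent_field F \<theta>)) = UNIV"

(* Twisted polynomials in tau are represented by their coefficients: the "polynomial"
   [:c0, c1, ..., cn:] stands for c0 + c1 tau + ... + cn tau^n.  The ring structure of 'a poly
   is not that of the twisted polynomial ring; only the actions below, in which tau is the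
   q-th power map, are used. *)
definition twisted_act :: "nat \<Rightarrow> 'a::field poly \<Rightarrow> 'a \<Rightarrow> 'a" where
  "twisted_act q D x = (\<Sum>i\<le>degree D. coeff D i * x ^ (q ^ i))"

definition twisted_act_fps :: "nat \<Rightarrow> 'a::field poly \<Rightarrow> 'a fps \<Rightarrow> 'a fps" where
  "twisted_act_fps q D E = (\<Sum>i\<le>degree D. fps_const (coeff D i) * E ^ (q ^ i))"

definition twisted_mat_act :: "nat \<Rightarrow> 'a::field poly ^ 'n ^ 'm \<Rightarrow> 'a ^ 'n \<Rightarrow> 'a ^ 'm" where
  "twisted_mat_act q M z = (\<chi> i. \<Sum>j\<in>UNIV. twisted_act q (M $ i $ j) (z $ j))"

definition rho_t :: "'a::field \<Rightarrow> 'a \<Rightarrow> 'a \<Rightarrow> 'a poly" where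
  "rho_t \<theta> \<kappa> \<Delta> = [:\<theta>, \<kappa>, \<Delta>:]"

definition carlitz_t :: "'a::field \<Rightarrow> 'a poly" where
  "carlitz_t \<theta> = [:\<theta>, 1:]"

definition phi_t :: "'a::field \<Rightarrow> 'a \<Rightarrow> 'a \<Rightarrow> 'a \<Rightarrow> 'a poly ^ 2 ^ 2" where
  "phi_t \<theta> \<kappa> \<Delta> \<alpha> =
     vector [vector [rho_t \<theta> \<kappa> \<Delta>, 0],
             vector [[:0, \<alpha>:],   carlitz_t \<theta>]]"

definition fps_value :: "'a::complete_alg_closed_valued_field fps \<Rightarrow> 'a \<Rightarrow> 'a" where
  "fps_value f z = (\<Sum>n. fps_nth f n * z ^ n)"

(* The exponential series of the Drinfeld (or Carlitz) module whose value at t is D;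
   composition with theta X is the substitution of theta z for z. *)
definition exp_series :: "nat \<Rightarrow> 'a::field \<Rightarrow> 'a poly \<Rightarrow> 'a fps" where
  "exp_series q \<theta> D = (THE E.
     fps_nth E 1 = 1 \<and> (\<forall>n. fps_nth E n \<noteq> 0 \<longrightarrow> (\<exists>i. n = q ^ i)) \<and>
     fps_compose E (fps_const \<theta> * fps_X) = twisted_act_fps q D E)"

definition quasi_periodic_series :: "nat \<Rightarrow> 'a::field \<Rightarrow> 'a poly \<Rightarrow> 'a fps" where
  "quasi_periodic_series q \<theta> D = (THE G.
     (\<forall>n<q. fps_nth G n = 0) \<and>
     fps_compose G (fps_const \<theta> * fps_X) - fps_const \<theta> * G = exp_series q \<theta> D ^ q)"

definition drinfeld_exp ::
    "nat \<Rightarrow> 'a::complete_alg_closed_valued_field \<Rightarrow> 'a poly \<Rightarrow> 'a \<Rightarrow> 'a" where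
  "drinfeld_exp q \<theta> D = fps_value (exp_series q \<theta> D)"

definition quasi_periodic_tau ::
    "nat \<Rightarrow> 'a::complete_alg_closed_valued_field \<Rightarrow> 'a poly \<Rightarrow> 'a \<Rightarrow> 'a" where
  "quasi_periodic_tau q \<theta> D = fps_value (quasi_periodic_series q \<theta> D)"

definition Fq_linear :: "'a::field set \<Rightarrow> ('a ^ 'n \<Rightarrow> 'a ^ 'm) \<Rightarrow> bool" where
  "Fq_linear F f \<longleftrightarrow>
     (\<forall>x y. f (x + y) = f x + f y) \<and> (\<forall>c\<in>F. \<forall>x. f (c *s x) = c *s f x)"

(* f is entire: it is given by an everywhere convergent power series in the two coordinates,
   c m n being the (vector) coefficient of z1^m z2^n. *)
definition has_entire_expansion ::
    "('a::complete_alg_closed_valued_field ^ 2 \<Rightarrow> 'a ^ 2) \<Rightarrow> (nat \<Rightarrow> nat \<Rightarrow> 'a ^ 2) \<Rightarrow> bool" where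
  "has_entire_expansion f c \<longleftrightarrow>
     (\<forall>z j. ((\<lambda>(m, n). c m n $ j * (z $ 1) ^ m * (z $ 2) ^ n) has_sum (f z $ j)) UNIV)"

(* The condition on m + n < q says that f(z) agrees with z modulo terms of degree at least q. *)
definition tmodule_exp ::
    "nat \<Rightarrow> 'a::complete_alg_closed_valued_field set \<Rightarrow> 'a \<Rightarrow> 'a poly ^ 2 ^ 2 \<Rightarrow> 'a ^ 2 \<Rightarrow> 'a ^ 2" where
  "tmodule_exp q F \<theta> M = (THE f.
     Fq_linear F f \<and>
     (\<exists>c. has_entire_expansion f c \<and>
        (\<forall>m n. m + n < q \<longrightarrow>
           c m n = (if (m, n) = (1, 0) then axis 1 1
                    else if (m, n) = (0, 1) then axis 2 1 else 0))) \<and>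
     (\<forall>z. f (\<theta> *s z) = twisted_mat_act q M (f z)))"

(* pi generates the period lattice of the Carlitz module over F_q[theta]. *)
definition carlitz_period ::
    "nat \<Rightarrow> 'a::complete_alg_closed_valued_field set \<Rightarrow> 'a \<Rightarrow> 'a \<Rightarrow> bool" where
  "carlitz_period q F \<theta> \<pi> \<longleftrightarrow>
     {z. drinfeld_exp q \<theta> (carlitz_t \<theta>) z = 0} = {poly a \<theta> * \<pi> | a. a \<in> polys_over F}"

end

(* Put D f (z) = f (theta z) - theta f (z).  The exponential of phi is
   (z1, z2) |-> (e z1, exp_C z2 + G_alpha z1), where e = exp_rho, D G_alpha = G_alpha^q + alpha e^q
   and G_alpha = O (z^q); the same construction makes sense for every alpha.  An O (z^q) solution
   of D h = h^q vanishes, because z |-> C_t z expands small values only by the factor |theta|.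
   Since r^q = - Delta r, this uniqueness principle gives, for every a,
     G_{r rho_t(a)} (z) - C_t (G_{r a} (z)) + exp_C (r a^q z) = r a^q e (z).
   At a period omega of rho the right-hand side is 0, so u |-> G_{r e(u)} (omega) satisfies
   the same functional equation as u |-> exp_C (r (u F_tau(omega) - omega F_tau(u))).  Both have
   the linear term r F_tau(omega) u, so they agree, again by uniqueness.  A period (omega, lam) of
   phi with alpha = r e(u) thus makes lam + r (u F_tau(omega) - omega F_tau(u)) a Carlitz period. *)

theory Submission
  imports Defs
begin

subsection \<open>Ultrametric analysis\<close>

text \<open>The two identities are not proved by comparing power series: in the second one the
  variable is u, the functions are composites such as u |-> G_{r e(u)} (omega), and expanding them
  would mean rearranging double series. The uniqueness principle is therefore stated for an
  arbitrary map with a local bound of order q at 0. At z / \<theta>^n such a map has size at most a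
  constant times |\<theta>|^(-q n), whereas each application of the equation on the way back to z
  multiplies a small value by at most |\<theta>|. Since q is at least 2, the decay wins and the
  value at z is 0. The exponentials and F_tau are given by definite descriptions, so none of their
  properties is available before existence and uniqueness are settled. Explicit recursions for the
  coefficients settle the one-variable series. For the exponential of phi they give existence and
  convergence, while uniqueness comes from the same expansion argument, applied to vectors.\<close>

context complete_alg_closed_valued_field
begin

lemma absval_eq_dist: "absval x = dist x 0"
  by (simp add: absval_dist)

lemma absval_nonneg [simp]: "0 \<le> absval x"
  by (simp add: absval_eq_dist)

lemma absval_eq_0_iff [simp]: "absval x = 0 \<longleftrightarrow> x = 0"
  by (simp add: absval_eq_dist)

lemma absval_0 [simp]: "absval 0 = 0"
  by simp

lemma absval_pos_iff [simp]: "0 < absval x \<longleftrightarrow> x \<noteq> 0"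
  using absval_nonneg[of x] absval_eq_0_iff[of x] by linarith

lemma absval_le_0_iff [simp]: "absval x \<le> 0 \<longleftrightarrow> x = 0"
  using absval_nonneg[of x] absval_eq_0_iff[of x] by linarith

lemma absval_1 [simp]: "absval 1 = 1"
  using absval_mult[of 1 1] absval_eq_0_iff[of 1] by simp

lemma absval_minus [simp]: "absval (- x) = absval x"
  using absval_dist[of 0 x] absval_dist[of x 0] by (simp add: dist_commute)

lemma absval_minus_commute: "absval (x - y) = absval (y - x)"
  by (metis absval_minus minus_diff_eq)

lemma absval_power: "absval (x ^ n) = absval x ^ n"
  by (induction n) (simp_all add: absval_mult)

lemma absval_divide: "absval (x / y) = absval x / absval y"
proof (cases "y = 0")
  case False
  then have "absval x = absval (x / y) * absval y"
    by (simp flip: absval_mult)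
  with False show ?thesis by (simp add: field_simps)
qed simp

lemma absval_add_le: "absval x \<le> B \<Longrightarrow> absval y \<le> B \<Longrightarrow> absval (x + y) \<le> B"
  using absval_ultrametric[of x y] by linarith

lemma absval_diff_le: "absval x \<le> B \<Longrightarrow> absval y \<le> B \<Longrightarrow> absval (x - y) \<le> B"
  using absval_add_le[of x B "- y"] by simp

lemma absval_add_eq:
  assumes "absval y < absval x"
  shows "absval (x + y) = absval x"
proof (rule antisym)
  show "absval (x + y) \<le> absval x"
    using assms by (intro absval_add_le) auto
  have "absval x \<le> max (absval (x + y)) (absval y)"
    using absval_ultrametric[of "x + y" "- y"] by simp
  then show "absval x \<le> absval (x + y)"
    using assms by linarith
qed

lemma absval_sum_le:
  assumes "0 \<le> B" "\<And>i. i \<in> A \<Longrightarrow> absval (f i) \<le> B"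
  shows "absval (sum f A) \<le> B"
  using assms by (induction A rule: infinite_finite_induct) (auto intro: absval_add_le)

end

text \<open>Supplies the group topology that the rules for \<open>sums\<close>,
  \<open>suminf\<close> and \<open>has_sum\<close> ask for. Addition is continuous because the
  metric comes from \<open>absval\<close>, so that the distance of two sums is at most the sum of
  the distances.\<close>

instance complete_alg_closed_valued_field \<subseteq> topological_ab_group_add
proof
  fix a b :: 'a
  show "((\<lambda>x. fst x + snd x) \<longlongrightarrow> a + b) (nhds a \<times>\<^sub>F nhds b)"
  proof (rule iffD2[OF tendsto_dist_iff],
      rule tendsto_sandwich[of "\<lambda>_. 0" _ _ "\<lambda>x. dist (fst x) a + dist (snd x) b"])
    show "\<forall>\<^sub>F x in nhds a \<times>\<^sub>F nhds b. dist (fst x + snd x) (a + b) \<le> dist (fst x) a + dist (snd x) b"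
    proof (intro always_eventually allI)
      fix x :: "'a \<times> 'a"
      have "absval ((fst x - a) + (snd x - b)) \<le> absval (fst x - a) + absval (snd x - b)"
        using absval_ultrametric[of "fst x - a" "snd x - b"] absval_nonneg[of "fst x - a"]
          absval_nonneg[of "snd x - b"] by linarith
      then show "dist (fst x + snd x) (a + b) \<le> dist (fst x) a + dist (snd x) b"
        by (simp add: absval_dist algebra_simps)
    qed
    have "((\<lambda>x. dist (fst x) a + dist (snd x) b) \<longlongrightarrow> dist a a + dist b b) (nhds a \<times>\<^sub>F nhds b)"
      by (intro tendsto_add tendsto_dist tendsto_const filterlim_fst filterlim_snd)
    then show "((\<lambda>x. dist (fst x) a + dist (snd x) b) \<longlongrightarrow> 0) (nhds a \<times>\<^sub>F nhds b)"
      by simp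
  qed auto
next
  fix a :: 'a
  have "dist (- x) (- a) = dist x a" for x
    by (metis absval_dist absval_minus_commute minus_diff_minus absval_minus)
  moreover have "((\<lambda>x. dist x a) \<longlongrightarrow> dist a a) (nhds a)"
    by (intro tendsto_intros) (rule filterlim_ident)
  ultimately show "(uminus \<longlongrightarrow> - a) (nhds a)"
    by (subst tendsto_dist_iff) simp
qed

text \<open>The accuracy \<open>absval x\<close> already suffices: a point closer to
  \<open>x\<close> than that has the same absolute value, so bounds pass to limits without
  loss.\<close>

lemma absval_le_if_approx:
  assumes "0 \<le> B" "\<And>\<epsilon>. 0 < \<epsilon> \<Longrightarrow> \<exists>y. absval y \<le> B \<and> absval (x - y) < \<epsilon>"
  shows "absval x \<le> B"
proof (cases "x = 0")
  case False
  then obtain y where y: "absval y \<le> B" "absval (x - y) < absval x"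
    using assms(2)[of "absval x"] by auto
  have "absval x \<le> max (absval (x - y)) (absval y)"
    using absval_ultrametric[of "x - y" y] by simp
  with y show ?thesis by linarith
qed (use assms in auto)

section \<open>Convergence of series over an ultrametric field\<close>

lemma LIMSEQ_absval_iff: "X \<longlonglongrightarrow> L \<longleftrightarrow> (\<lambda>n. absval (X n - L)) \<longlonglongrightarrow> 0"
  by (subst tendsto_dist_iff) (simp add: absval_dist)

text \<open>A finite block of terms is no larger than its largest term, so null terms alone make the
  partial sums Cauchy.\<close>

lemma summable_if_absval_null:
  fixes f :: "nat \<Rightarrow> 'a::complete_alg_closed_valued_field"
  assumes "(\<lambda>n. absval (f n)) \<longlonglongrightarrow> 0"
  shows "summable f"
proof -
  have "Cauchy (\<lambda>n. sum f {..<n})"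
  proof (rule metric_CauchyI)
    fix \<epsilon> :: real assume "0 < \<epsilon>"
    then have "\<forall>\<^sub>F n in sequentially. absval (f n) < \<epsilon> / 2"
      using order_tendstoD(2)[OF assms, of "\<epsilon> / 2"] by simp
    then obtain N where N: "\<And>n. n \<ge> N \<Longrightarrow> absval (f n) < \<epsilon> / 2"
      by (auto simp: eventually_sequentially)
    \<comment> \<open>Both partial sums are later compared with the one at \<open>N\<close>, which
      avoids ordering the two indices.\<close>
    have "absval (sum f {..<m} - sum f {..<N}) \<le> \<epsilon> / 2" if "m \<ge> N" for m
    proof -
      have "sum f {..<m} - sum f {..<N} = sum f ({..<m} - {..<N})"
        using that by (subst sum_diff) auto
      also have "absval \<dots> \<le> \<epsilon> / 2"
        using N \<open>0 < \<epsilon>\<close> by (intro absval_sum_le) (auto intro: less_imp_le)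
      finally show ?thesis .
    qed note * = this
    have "dist (sum f {..<m}) (sum f {..<n}) < \<epsilon>" if "m \<ge> N" "n \<ge> N" for m n
    proof -
      have "absval ((sum f {..<m} - sum f {..<N}) - (sum f {..<n} - sum f {..<N})) \<le> \<epsilon> / 2"
        using that by (intro absval_diff_le *)
      then show ?thesis
        using \<open>0 < \<epsilon>\<close> by (simp add: absval_dist)
    qed
    then show "\<exists>M. \<forall>m\<ge>M. \<forall>n\<ge>M. dist (sum f {..<m}) (sum f {..<n}) < \<epsilon>"
      by blast
  qed
  then show ?thesis
    by (simp add: summable_iff_convergent Cauchy_convergent_iff)
qed

lemma absval_sums_le:
  fixes f :: "nat \<Rightarrow> 'a::complete_alg_closed_valued_field"
  assumes "f sums s" "0 \<le> B" "\<And>n. absval (f n) \<le> B"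
  shows "absval s \<le> B"
proof (rule absval_le_if_approx)
  fix \<epsilon> :: real assume "0 < \<epsilon>"
  have "(\<lambda>n. absval (sum f {..<n} - s)) \<longlonglongrightarrow> 0"
    using assms(1) by (simp add: sums_def LIMSEQ_absval_iff)
  then have "\<forall>\<^sub>F n in sequentially. absval (sum f {..<n} - s) < \<epsilon>"
    using order_tendstoD(2) \<open>0 < \<epsilon>\<close> by blast
  then obtain n where "absval (sum f {..<n} - s) < \<epsilon>"
    by (auto simp: eventually_sequentially)
  moreover have "absval (sum f {..<n}) \<le> B"
    using assms by (intro absval_sum_le)
  ultimately show "\<exists>y. absval y \<le> B \<and> absval (s - y) < \<epsilon>"
    by (metis absval_minus_commute)
qed fact

text \<open>Additivity turns the growth bound into continuity at every point. The two instances are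
  multiplication by a constant, with \<open>k = 1\<close>, and the Frobenius map, with
  \<open>K = 1\<close> and \<open>k = q\<close>.\<close>

lemma additive_sums:
  fixes f :: "nat \<Rightarrow> 'a::complete_alg_closed_valued_field"
  assumes "f sums s" and h_add: "\<And>x y. h (x + y) = h x + h y"
    and h_le: "\<And>x. absval (h x) \<le> K * absval x ^ k" and "0 < k"
  shows "(\<lambda>n. h (f n) :: 'a) sums h s"
proof -
  interpret additive h by unfold_locales (rule h_add)
  have "(\<lambda>n. absval (sum f {..<n} - s)) \<longlonglongrightarrow> 0"
    using assms(1) by (simp add: sums_def LIMSEQ_absval_iff)
  then have "(\<lambda>n. K * absval (sum f {..<n} - s) ^ k) \<longlonglongrightarrow> K * 0 ^ k"
    by (intro tendsto_intros)
  then have lim: "(\<lambda>n. K * absval (sum f {..<n} - s) ^ k) \<longlonglongrightarrow> 0"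
    using \<open>0 < k\<close> by (simp add: zero_power)
  have "(\<lambda>n. absval (h (sum f {..<n}) - h s)) \<longlonglongrightarrow> 0"
    using lim by (rule tendsto_sandwich[OF _ _ tendsto_const, rotated 2])
      (simp_all add: h_le flip: diff)
  then show ?thesis
    by (simp add: sums_def LIMSEQ_absval_iff sum)
qed

lemma sums_cmult:
  fixes f :: "nat \<Rightarrow> 'a::complete_alg_closed_valued_field"
  assumes "f sums s"
  shows "(\<lambda>n. c * f n) sums (c * s)"
  by (rule additive_sums[OF assms, of "\<lambda>x. c * x" "absval c" 1])
    (simp_all add: absval_mult distrib_left)

section \<open>Unordered sums over an ultrametric field\<close>

lemma has_sum_metric:
  fixes s :: "'b::{comm_monoid_add, metric_space}"
  shows "(f has_sum s) A \<longleftrightarrow>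
    (\<forall>\<epsilon>>0. \<exists>X. finite X \<and> X \<subseteq> A \<and> (\<forall>Y. finite Y \<and> X \<subseteq> Y \<and> Y \<subseteq> A \<longrightarrow> dist (sum f Y) s < \<epsilon>))"
  by (simp add: has_sum_def tendsto_iff eventually_finite_subsets_at_top)

text \<open>Any finite set of indices outside a long initial segment has a small sum, so convergence
  does not depend on the order. This leads from \<open>sums\<close> to the \<open>has_sum\<close> of
  \<open>has_entire_expansion\<close>.\<close>

lemma null_sums_has_sum:
  fixes f :: "nat \<Rightarrow> 'a::complete_alg_closed_valued_field"
  assumes "f sums s" "(\<lambda>n. absval (f n)) \<longlonglongrightarrow> 0"
  shows "(f has_sum s) UNIV"
proof -
  have "\<exists>X. finite X \<and> X \<subseteq> UNIV \<and> (\<forall>Y. finite Y \<and> X \<subseteq> Y \<and> Y \<subseteq> UNIV \<longrightarrow> dist (sum f Y) s < \<epsilon>)"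
    if "0 < \<epsilon>" for \<epsilon>
  proof -
    have "\<forall>\<^sub>F n in sequentially. absval (f n) < \<epsilon> / 2"
      using order_tendstoD(2)[OF assms(2), of "\<epsilon> / 2"] that by simp
    moreover have "\<forall>\<^sub>F n in sequentially. absval (sum f {..<n} - s) < \<epsilon>"
      using assms(1) that unfolding sums_def LIMSEQ_absval_iff by (intro order_tendstoD(2))
    ultimately have "\<forall>\<^sub>F n in sequentially. absval (f n) < \<epsilon> / 2 \<and> absval (sum f {..<n} - s) < \<epsilon>"
      by (rule eventually_conj)
    then obtain N where N: "\<And>n. n \<ge> N \<Longrightarrow> absval (f n) < \<epsilon> / 2"
        "absval (sum f {..<N} - s) < \<epsilon>"
      by (auto simp: eventually_sequentially)
    have "dist (sum f Y) s < \<epsilon>" if "finite Y" "{..<N} \<subseteq> Y" for Y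
    proof -
      have "sum f Y = sum f {..<N} + sum f (Y - {..<N})"
        using that by (metis add.commute sum.subset_diff)
      moreover have "absval (sum f (Y - {..<N})) \<le> \<epsilon> / 2"
        using N \<open>0 < \<epsilon>\<close> by (intro absval_sum_le) (auto intro: less_imp_le)
      ultimately show ?thesis
        using absval_ultrametric[of "sum f {..<N} - s" "sum f (Y - {..<N})"] N(2) \<open>0 < \<epsilon>\<close>
        by (simp add: absval_dist algebra_simps)
    qed
    then show ?thesis
      by (intro exI[of _ "{..<N}"]) auto
  qed
  then show ?thesis
    unfolding has_sum_metric by blast
qed

text \<open>A term outside \<open>X\<close> is the difference of two finite sums that both lie
  within 1 of \<open>s\<close>; finitely many terms remain. The 1 inserted into the maximum covers
  the former and makes the bound positive.\<close>

lemma has_sum_absval_bounded: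
  fixes f :: "'i \<Rightarrow> 'a::complete_alg_closed_valued_field"
  assumes "(f has_sum s) UNIV"
  obtains C where "0 < C" "\<And>i. absval (f i) \<le> C"
proof -
  obtain X where X: "finite X" "\<And>Y. finite Y \<Longrightarrow> X \<subseteq> Y \<Longrightarrow> dist (sum f Y) s < 1"
    using assms unfolding has_sum_metric by (metis top_greatest zero_less_one)
  have "absval (f i) \<le> Max (insert 1 ((\<lambda>i. absval (f i)) ` X))" for i
  proof (cases "i \<in> X")
    case False
    have "f i = (sum f (insert i X) - s) - (sum f X - s)"
      using False X(1) by simp
    also have "absval \<dots> \<le> 1"
    proof (rule absval_diff_le)
      show "absval (sum f (insert i X) - s) \<le> 1" "absval (sum f X - s) \<le> 1"
        using X(2)[OF _ subset_insertI, of i] X(2)[of X] X(1) by (auto simp: absval_dist)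
    qed
    finally show ?thesis
      using X(1) by (auto simp: Max_ge_iff)
  qed (use X(1) in \<open>auto simp: Max_ge_iff\<close>)
  moreover have "0 < Max (insert 1 ((\<lambda>i. absval (f i)) ` X))"
    using X(1) by (simp add: Max_gr_iff)
  ultimately show ?thesis using that by blast
qed

lemma has_sum_absval_diff_le:
  fixes f :: "'i \<Rightarrow> 'a::complete_alg_closed_valued_field"
  assumes "(f has_sum s) UNIV" "finite X" "0 \<le> B" "\<And>i. i \<notin> X \<Longrightarrow> absval (f i) \<le> B"
  shows "absval (s - sum f X) \<le> B"
proof (rule absval_le_if_approx)
  fix \<epsilon> :: real assume "0 < \<epsilon>"
  then obtain Z where Z: "finite Z" "\<And>Y. finite Y \<Longrightarrow> Z \<subseteq> Y \<Longrightarrow> dist (sum f Y) s < \<epsilon>"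
    using assms(1) unfolding has_sum_metric by (metis top_greatest)
  have "absval (sum f (Z - X)) \<le> B"
    using assms by (intro absval_sum_le) auto
  moreover have "sum f (Z \<union> X) = sum f X + sum f (Z - X)"
    using Z(1) assms(2) by (metis Un_Diff_cancel Un_commute finite_Diff sum.union_disjoint Diff_disjoint)
  then have "absval (s - sum f X - sum f (Z - X)) < \<epsilon>"
    using Z(2)[of "Z \<union> X"] Z(1) assms(2)
    by (simp add: dist_commute absval_dist algebra_simps)
  ultimately show "\<exists>y. absval y \<le> B \<and> absval (s - sum f X - y) < \<epsilon>"
    by blast
qed fact

text \<open>A big-O estimate rather than a statement on coefficients, so that it survives
  composition of maps. The constant may be negative, which is why \<open>\<bar>C\<bar>\<close>
  appears wherever the bound is enlarged.\<close>

definition order_at_zero ::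
    "nat \<Rightarrow> ('a::complete_alg_closed_valued_field \<Rightarrow> 'a) \<Rightarrow> bool" where
  "order_at_zero k h \<longleftrightarrow> (\<exists>C. \<forall>\<^sub>F x in nhds 0. absval (h x) \<le> C * absval x ^ k)"

lemma eventually_absval_le: "0 < \<delta> \<Longrightarrow> \<forall>\<^sub>F x in nhds 0. absval x \<le> \<delta>"
  unfolding eventually_nhds_metric by (auto simp: absval_eq_dist intro!: exI[of _ \<delta>] less_imp_le)

lemma order_at_zeroI:
  assumes "0 < \<delta>" "\<And>x. absval x \<le> \<delta> \<Longrightarrow> absval (h x) \<le> C * absval x ^ k"
  shows "order_at_zero k h"
  unfolding order_at_zero_def
  by (rule exI[of _ C], rule eventually_mono[OF eventually_absval_le[OF assms(1)]])
    (rule assms(2))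

lemma order_at_zero_add:
  assumes "order_at_zero k f" "order_at_zero k g"
  shows "order_at_zero k (\<lambda>x. f x + g x)"
proof -
  obtain C D where "\<forall>\<^sub>F x in nhds 0. absval (f x) \<le> C * absval x ^ k"
      "\<forall>\<^sub>F x in nhds 0. absval (g x) \<le> D * absval x ^ k"
    using assms unfolding order_at_zero_def by blast
  then have "\<forall>\<^sub>F x in nhds 0. absval (f x + g x) \<le> max C D * absval x ^ k"
  proof eventually_elim
    case (elim x)
    have "C * absval x ^ k \<le> max C D * absval x ^ k" "D * absval x ^ k \<le> max C D * absval x ^ k"
      by (auto intro!: mult_right_mono)
    with elim show ?case by (intro absval_add_le) linarith+
  qed
  then show ?thesis unfolding order_at_zero_def by blast
qed

lemma order_at_zero_cmult:
  assumes "order_at_zero k f"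
  shows "order_at_zero k (\<lambda>x. c * f x)"
proof -
  obtain C where "\<forall>\<^sub>F x in nhds 0. absval (f x) \<le> C * absval x ^ k"
    using assms unfolding order_at_zero_def by blast
  then have "\<forall>\<^sub>F x in nhds 0. absval (c * f x) \<le> (absval c * C) * absval x ^ k"
    by eventually_elim (simp add: absval_mult mult_left_mono mult.assoc)
  then show ?thesis unfolding order_at_zero_def by blast
qed

lemma order_at_zero_diff:
  assumes "order_at_zero k f" "order_at_zero k g"
  shows "order_at_zero k (\<lambda>x. f x - g x)"
  using order_at_zero_add[OF assms(1) order_at_zero_cmult[OF assms(2), of "-1"]] by simp

lemma order_at_zero_ident: "order_at_zero 1 (\<lambda>x. x)"
  by (rule order_at_zeroI[of 1 _ 1]) auto

lemma order_at_zero_mono: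
  assumes "order_at_zero k f" "l \<le> k"
  shows "order_at_zero l f"
proof -
  obtain C where "\<forall>\<^sub>F x in nhds 0. absval (f x) \<le> C * absval x ^ k"
    using assms unfolding order_at_zero_def by blast
  moreover have "\<forall>\<^sub>F x :: 'a in nhds 0. absval x \<le> 1"
    by (rule eventually_absval_le) simp
  ultimately have "\<forall>\<^sub>F x in nhds 0. absval (f x) \<le> \<bar>C\<bar> * absval x ^ l"
  proof eventually_elim
    case (elim x)
    note elim(1)
    also have "C * absval x ^ k \<le> \<bar>C\<bar> * absval x ^ l"
      using elim(2) assms(2) by (intro mult_mono power_decreasing) auto
    finally show ?case .
  qed
  then show ?thesis unfolding order_at_zero_def by blast
qed

text \<open>Order 1 makes the inner map tend to 0, so that the outer bound, which is only local,
  applies to its values.\<close>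

lemma order_at_zero_compose:
  assumes "order_at_zero k f" "order_at_zero 1 g"
  shows "order_at_zero k (\<lambda>x. f (g x))"
proof -
  obtain C D where f: "\<forall>\<^sub>F x in nhds 0. absval (f x) \<le> C * absval x ^ k"
      and g: "\<forall>\<^sub>F x in nhds 0. absval (g x) \<le> D * absval x"
    using assms unfolding order_at_zero_def by auto
  have "((\<lambda>x. D * absval x) \<longlongrightarrow> D * dist 0 (0::'a)) (nhds (0::'a))"
    unfolding absval_eq_dist
    by (rule tendsto_mult[OF tendsto_const tendsto_dist[OF filterlim_ident tendsto_const]])
  then have "((\<lambda>x. D * absval x) \<longlongrightarrow> 0) (nhds (0::'a))" by simp
  then have "((\<lambda>x. absval (g x)) \<longlongrightarrow> 0) (nhds 0)"
    by (rule tendsto_sandwich[OF _ g tendsto_const, rotated]) auto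
  then have "filterlim g (nhds 0) (nhds 0)"
    by (subst tendsto_dist_iff) (simp add: absval_dist)
  then have "\<forall>\<^sub>F x in nhds 0. absval (f (g x)) \<le> C * absval (g x) ^ k"
    using f by (rule eventually_compose_filterlim[rotated])
  then have "\<forall>\<^sub>F x in nhds 0. absval (f (g x)) \<le> (\<bar>C\<bar> * D ^ k) * absval x ^ k"
    using g
  proof eventually_elim
    case (elim x)
    note elim(1)
    also have "C * absval (g x) ^ k \<le> \<bar>C\<bar> * (D * absval x) ^ k"
      using elim(2) by (intro mult_mono power_mono) auto
    finally show ?case by (simp add: power_mult_distrib mult.assoc)
  qed
  then show ?thesis unfolding order_at_zero_def by blast
qed

text \<open>Here \<open>x n\<close> stands for the size of a solution at z / \<theta>^n and
  \<open>Q\<close> for |\<theta>|. From some \<open>N\<close> on all values are below the threshold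
  \<open>\<delta>\<close>, hence \<open>x N\<close> is at most \<open>Q ^ k * x (N + k)\<close>, and
  the quadratic decay \<open>Q ^ 2\<close> beats the linear loss as \<open>k\<close> grows.\<close>

lemma expansion_null:
  fixes x :: "nat \<Rightarrow> real"
  assumes "1 < Q" "0 < \<delta>" "\<And>n. 0 \<le> x n"
    and step: "\<And>n. x (Suc n) \<le> \<delta> \<Longrightarrow> x n \<le> Q * x (Suc n)"
    and small: "\<forall>\<^sub>F n in sequentially. x n \<le> C / (Q ^ 2) ^ n"
  shows "x 0 = 0"
proof -
  have lim: "(\<lambda>n. C / R ^ n) \<longlonglongrightarrow> 0" if "1 < R" for R :: real
    using tendsto_mult[OF tendsto_const[of C] LIMSEQ_inverse_realpow_zero[OF that]]
    by (simp add: divide_inverse)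
  have "\<forall>\<^sub>F n in sequentially. C / (Q ^ 2) ^ n < \<delta>"
    using assms by (intro order_tendstoD(2)[OF lim]) (auto simp: one_less_power)
  with small have "\<forall>\<^sub>F n in sequentially. x n \<le> C / (Q ^ 2) ^ n \<and> x n \<le> \<delta>"
    by eventually_elim auto
  then obtain N where N: "\<And>n. n \<ge> N \<Longrightarrow> x n \<le> C / (Q ^ 2) ^ n" "\<And>n. n \<ge> N \<Longrightarrow> x n \<le> \<delta>"
    by (auto simp: eventually_sequentially)
  have up: "x N \<le> Q ^ k * x (N + k)" for k
  proof (induction k)
    case (Suc k)
    have "x (N + k) \<le> Q * x (N + Suc k)"
      using step[of "N + k"] N(2)[of "N + Suc k"] by simp
    then have "Q ^ k * x (N + k) \<le> Q ^ k * (Q * x (N + Suc k))"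
      using \<open>1 < Q\<close> by (intro mult_left_mono) auto
    with Suc show ?case by (simp add: mult.assoc mult.left_commute)
  qed simp
  have "x N \<le> C / (Q ^ 2) ^ N / Q ^ k" for k
  proof -
    have "x N \<le> Q ^ k * (C / (Q ^ 2) ^ (N + k))"
      using up[of k] N(1)[of "N + k"] \<open>1 < Q\<close>
      by (meson le_add1 mult_left_mono order_trans zero_le_power zero_le_one less_imp_le)
    also have "\<dots> = C / (Q ^ 2) ^ N / Q ^ k"
      using \<open>1 < Q\<close> by (simp add: power_add field_simps power2_eq_square power_mult_distrib)
    finally show ?thesis .
  qed
  moreover have "(\<lambda>k. C / (Q ^ 2) ^ N / Q ^ k) \<longlonglongrightarrow> 0"
    using tendsto_mult[OF tendsto_const[of "C / (Q ^ 2) ^ N"] LIMSEQ_inverse_realpow_zero[OF \<open>1 < Q\<close>]]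
    by (simp add: divide_inverse)
  ultimately have "x N \<le> 0"
    by (intro LIMSEQ_le_const[of _ 0]) auto
  then have "x N = 0" using assms(3)[of N] by simp
  \<comment> \<open>Before \<open>N\<close> nothing is known to be small, but the value 0 lies below
    the threshold, so vanishing descends one index at a time. Truncated subtraction makes the
    sequence constant once 0 is reached.\<close>
  then have "x (N - k) = 0" for k
  proof (induction k)
    case (Suc k)
    show ?case
    proof (cases "N - k = 0")
      case True
      then have "N - Suc k = N - k" by simp
      with Suc show ?thesis by simp
    next
      case False
      then have "Suc (N - Suc k) = N - k" by simp
      with step[of "N - Suc k"] Suc assms(2) assms(3)[of "N - Suc k"] show ?thesis by auto
    qed
  qed simp
  from this[of N] show ?thesis by simp
qed

lemma null_if_le_null:
  fixes f g :: "nat \<Rightarrow> real"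
  assumes "g \<longlonglongrightarrow> 0" "\<And>n. f n \<le> g n" "\<And>n. 0 \<le> f n"
  shows "f \<longlonglongrightarrow> 0"
  by (rule tendsto_sandwich[OF _ _ tendsto_const assms(1)]) (simp_all add: assms)

lemma sums_Suc_tail:
  fixes f :: "nat \<Rightarrow> 'a::{t2_space, topological_ab_group_add}"
  shows "(\<lambda>n. f (Suc n)) sums (s - f 0) \<longleftrightarrow> f sums s"
proof -
  have "(\<lambda>n. f (Suc n)) sums (s - f 0) \<longleftrightarrow> (\<lambda>n. sum f {..<Suc n}) \<longlonglongrightarrow> s"
  proof
    assume "(\<lambda>n. f (Suc n)) sums (s - f 0)"
    then have "(\<lambda>n. f 0 + (\<Sum>i<n. f (Suc i))) \<longlonglongrightarrow> f 0 + (s - f 0)"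
      unfolding sums_def by (rule tendsto_add[OF tendsto_const])
    then show "(\<lambda>n. sum f {..<Suc n}) \<longlonglongrightarrow> s"
      by (simp only: sum.lessThan_Suc_shift) (simp add: algebra_simps)
  next
    assume "(\<lambda>n. sum f {..<Suc n}) \<longlonglongrightarrow> s"
    then have "(\<lambda>n. sum f {..<Suc n} - f 0) \<longlonglongrightarrow> s - f 0"
      by (rule tendsto_diff[OF _ tendsto_const])
    then show "(\<lambda>n. f (Suc n)) sums (s - f 0)"
      unfolding sums_def by (simp only: sum.lessThan_Suc_shift) (simp add: algebra_simps)
  qed
  then show ?thesis
    by (simp only: sums_def filterlim_sequentially_Suc[of "\<lambda>n. sum f {..<n}"])
qed

subsection \<open>Action of twisted polynomials\<close>

text \<open>The degree of \<open>rho_t\<close> depends on which of \<kappa> and \<Delta> vanish;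
  summing up to a fixed bound gives one formula for all cases.\<close>

lemma sum_coeff_eq:
  assumes "degree D \<le> N" "\<And>i. g i 0 = 0"
  shows "(\<Sum>i\<le>degree D. g i (coeff D i)) = (\<Sum>i\<le>N. g i (coeff D i))"
  using assms by (intro sum.mono_neutral_left) (auto simp: coeff_eq_0)

lemma degree_rho_t: "degree (rho_t \<theta> \<kappa> \<Delta>) \<le> 2"
  by (rule degree_le) (auto simp: rho_t_def coeff_pCons split: nat.splits)

text \<open>Makes the Carlitz exponential the instance \<open>exp_coeff 1 0\<close>, so that its
  convergence, order and functional equation come from the general ones.\<close>

lemma carlitz_t_eq_rho_t: "carlitz_t \<theta> = rho_t \<theta> 1 0"
  by (simp add: carlitz_t_def rho_t_def)

lemma twisted_act_rho_t:
  "twisted_act q (rho_t \<theta> \<kappa> \<Delta>) x = \<theta> * x + \<kappa> * x ^ q + \<Delta> * x ^ (q ^ 2)"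
  unfolding twisted_act_def sum_coeff_eq[OF degree_rho_t, of "\<lambda>i c. c * x ^ (q ^ i)", simplified]
  by (simp add: rho_t_def eval_nat_numeral)

lemma twisted_act_fps_rho_t:
  "twisted_act_fps q (rho_t \<theta> \<kappa> \<Delta>) E =
     fps_const \<theta> * E + fps_const \<kappa> * E ^ q + fps_const \<Delta> * E ^ (q ^ 2)"
  unfolding twisted_act_fps_def
    sum_coeff_eq[OF degree_rho_t, of "\<lambda>i c. fps_const c * E ^ (q ^ i)", simplified]
  by (simp add: rho_t_def eval_nat_numeral)

subsection \<open>The Frobenius map\<close>

text \<open>Stated over a commutative ring because it serves both the field and its power series
  ring.\<close>

lemma add_power_eq_if_binomials_vanish:
  fixes x y :: "'b::comm_ring_1"
  assumes "0 < n" "\<And>k. 0 < k \<Longrightarrow> k < n \<Longrightarrow> of_nat (n choose k) = (0::'b)"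
  shows "(x + y) ^ n = x ^ n + y ^ n"
proof -
  have "(x + y) ^ n = (\<Sum>k\<le>n. of_nat (n choose k) * x ^ k * y ^ (n - k))"
    by (rule binomial_ring)
  also have "\<dots> = (\<Sum>k\<in>{0, n}. of_nat (n choose k) * x ^ k * y ^ (n - k))"
    using assms by (intro sum.mono_neutral_right) auto
  finally show ?thesis
    using \<open>0 < n\<close> by (simp add: add.commute)
qed

lemma subfield_setD:
  assumes "subfield_set S"
  shows "0 \<in> S" "1 \<in> S" "x \<in> S \<Longrightarrow> y \<in> S \<Longrightarrow> x + y \<in> S"
    "x \<in> S \<Longrightarrow> y \<in> S \<Longrightarrow> x * y \<in> S" "x \<in> S \<Longrightarrow> - x \<in> S" "x \<in> S \<Longrightarrow> inverse x \<in> S"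
  using assms by (auto simp: subfield_set_def)

text \<open>Multiplication by a nonzero \<open>c\<close> permutes the nonzero elements and hence
  fixes their product.\<close>

lemma subfield_power_card:
  assumes "subfield_set S" "finite S" "c \<in> S"
  shows "c ^ card S = c"
proof (cases "c = 0")
  case True
  then show ?thesis
    using assms subfield_setD(1)[OF assms(1)] by (auto simp: zero_power card_gt_0_iff)
next
  case False
  note S = subfield_setD[OF assms(1)]
  let ?U = "S - {0}"
  have "bij_betw (\<lambda>x. c * x) ?U ?U"
  proof (rule bij_betwI[where g = "\<lambda>x. inverse c * x"])
  qed (use False assms(3) S in auto)
  then have "(\<Prod>x\<in>?U. c * x) = \<Prod>?U"
    by (rule prod.reindex_bij_betw)
  then have "c ^ card ?U * \<Prod>?U = \<Prod>?U"
    by (simp add: prod.distrib)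
  moreover have "\<Prod>?U \<noteq> 0"
    using assms(2) by simp
  ultimately have "c ^ card ?U = 1"
    by simp
  moreover have "card S = Suc (card ?U)"
    using assms(2) S(1) by (rule card.remove)
  ultimately show ?thesis
    by simp
qed

text \<open>The polynomial \<open>(1 + X) ^ q - 1 - X ^ q\<close> has degree less than \<open>q\<close> and vanishes on all
  \<open>q\<close> elements of the subfield, so its coefficients are zero.\<close>

lemma subfield_of_nat_choose_card:
  fixes S :: "'a::field set"
  assumes "subfield_set S" "finite S" "0 < k" "k < card S"
  shows "of_nat (card S choose k) = (0 :: 'a)"
proof -
  note S = subfield_setD[OF assms(1)]
  let ?q = "card S"
  define p :: "'a poly" where "p = (\<Sum>k\<in>{0<..<?q}. monom (of_nat (?q choose k)) k)"
  have coeff_p: "coeff p i = (if 0 < i \<and> i < ?q then of_nat (?q choose i) else 0)" for i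
    by (simp add: p_def coeff_sum)
  have "poly p x = 0" if "x \<in> S" for x
  proof -
    have "x + 1 = (x + 1) ^ ?q"
      using that S by (simp add: subfield_power_card[OF assms(1,2)])
    also have "\<dots> = (\<Sum>k\<le>?q. of_nat (?q choose k) * x ^ k)"
      by (simp add: binomial_ring)
    also have "{..?q} = {0<..<?q} \<union> {0, ?q}"
      using assms(3,4) by auto
    also have "(\<Sum>k\<in>\<dots>. of_nat (?q choose k) * x ^ k) = poly p x + (1 + x ^ ?q)"
      using assms(3,4) by (subst sum.union_disjoint) (auto simp: p_def poly_sum poly_monom)
    also have "x ^ ?q = x"
      using that by (rule subfield_power_card[OF assms(1,2)])
    finally show ?thesis by simp
  qed
  then have "S \<subseteq> {x. poly p x = 0}" by blast
  have "p = 0"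
  proof (rule ccontr)
    assume "p \<noteq> 0"
    then have "finite {x. poly p x = 0}" "card {x. poly p x = 0} \<le> degree p"
      by (auto intro: poly_roots_finite card_poly_roots_bound)
    then have "?q \<le> degree p"
      using card_mono[OF _ \<open>S \<subseteq> {x. poly p x = 0}\<close>] by linarith
    moreover have "degree p < ?q"
      using assms(4) by (intro degree_lessI) (auto simp: coeff_p)
    ultimately show False by simp
  qed
  then show ?thesis
    using coeff_p[of k] assms(3,4) by simp
qed

context C_infinity
begin

lemma q_ge_2: "2 \<le> q"
proof -
  have "card {0, 1 :: 'a} \<le> card F"
    using subfield_setD(1,2)[OF subfield_F] finite_F by (intro card_mono) auto
  then show ?thesis by (simp add: card_F)
qed

lemma q_pos [simp]: "0 < q" "q \<noteq> 0"
  using q_ge_2 by simp_all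

lemma Suc_0_le_q [simp]: "Suc 0 \<le> q"
  using q_ge_2 by simp

lemma zero_power_q [simp]: "(0::'b::semiring_1) ^ q = 0" "(0::'b) ^ (q ^ i) = 0"
  by (simp_all add: zero_power)

lemma strict_mono_q_power: "strict_mono (\<lambda>i. q ^ i)"
  using q_ge_2 by (auto simp: strict_mono_def intro!: power_strict_increasing)

lemma q_power_eq_iff [simp]: "q ^ i = q ^ j \<longleftrightarrow> i = j"
  using strict_mono_q_power by (auto dest: strict_mono_eq)

lemma q_le_q_power: "0 < i \<Longrightarrow> q \<le> q ^ i"
  using power_increasing[of 1 i q] by simp

lemma frob_add: "(x + y :: 'a) ^ q = x ^ q + y ^ q"
  using subfield_of_nat_choose_card[OF subfield_F finite_F]
  by (intro add_power_eq_if_binomials_vanish) (auto simp: card_F)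

lemma frob_power_add: "(x + y :: 'a) ^ (q ^ i) = x ^ (q ^ i) + y ^ (q ^ i)"
proof (induction i)
  case (Suc i)
  then show ?case
    by (simp add: power_mult frob_add power_Suc2 del: power_Suc)
qed simp

lemma frob_diff: "(x - y :: 'a) ^ q = x ^ q - y ^ q"
  using frob_add[of "x - y" y] by (simp add: algebra_simps)

lemma frob_power_F: "c \<in> F \<Longrightarrow> c ^ (q ^ i) = c"
proof (induction i)
  case (Suc i)
  then show ?case
    using subfield_power_card[OF subfield_F finite_F, of c]
    by (simp add: power_mult card_F)
qed simp

lemma frob_add_fps: "(f + g :: 'a fps) ^ q = f ^ q + g ^ q"
proof (rule add_power_eq_if_binomials_vanish)
  fix k assume "0 < k" "k < q"
  then have "of_nat (q choose k) = (0 :: 'a)"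
    using subfield_of_nat_choose_card[OF subfield_F finite_F] by (simp add: card_F)
  then show "of_nat (q choose k) = (0 :: 'a fps)"
    by (metis fps_of_nat fps_const_0_eq_0)
qed simp

lemma frob_sum_fps:
  fixes f :: "nat \<Rightarrow> 'a fps"
  shows "(\<Sum>i\<in>A. f i) ^ q = (\<Sum>i\<in>A. f i ^ q)"
  by (induction A rule: infinite_finite_induct) (simp_all add: frob_add_fps)

text \<open>The Frobenius map is additive but has to be moved through an infinite sum. Cutting
  \<open>f\<close> off after degree \<open>m\<close> leaves a finite sum, and the q-th power of the
  tail starts only at degree \<open>q * Suc m\<close>, beyond \<open>m\<close>.\<close>

lemma fps_nth_power_q:
  fixes f :: "'a fps"
  shows "fps_nth (f ^ q) m = (if q dvd m then fps_nth f (m div q) ^ q else 0)"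
proof -
  let ?p = "\<Sum>n\<le>m. fps_const (fps_nth f n) * fps_X ^ n"
  have "f = ?p + fps_X ^ Suc m * fps_shift (Suc m) f"
    by (rule fps_ext) (auto simp: fps_sum_nth fps_X_power_mult_nth if_distrib simp del: power_Suc cong: if_cong)
  then have "f ^ q = (?p + fps_X ^ Suc m * fps_shift (Suc m) f) ^ q"
    by (rule arg_cong)
  also have "\<dots> = ?p ^ q + fps_X ^ (q * Suc m) * fps_shift (Suc m) f ^ q"
    unfolding frob_add_fps power_mult_distrib power_mult[symmetric] by (simp only: mult.commute)
  finally have "f ^ q = ?p ^ q + fps_X ^ (q * Suc m) * fps_shift (Suc m) f ^ q" .
  moreover have "fps_nth (fps_X ^ (q * Suc m) * fps_shift (Suc m) f ^ q) m = 0"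
  proof -
    have "m < q * Suc m" using q_pos(1) by (cases q) auto
    then show ?thesis by (simp add: fps_X_power_mult_nth)
  qed
  moreover have "fps_nth (?p ^ q) m = (\<Sum>n\<le>m. if m = q * n then fps_nth f n ^ q else 0)"
    unfolding frob_sum_fps
    by (auto simp: fps_sum_nth power_mult_distrib fps_const_power mult.commute
        simp flip: power_mult intro!: sum.cong)
  moreover have "\<dots> = (if q dvd m then fps_nth f (m div q) ^ q else 0)"
  proof (cases "q dvd m")
    case True
    then obtain k where k: "m = q * k" by auto
    moreover have "k \<le> m" "0 < q" using k by simp_all
    ultimately show ?thesis by simp
  qed (auto intro!: sum.neutral)
  ultimately show ?thesis by simp
qed

lemma absval_theta_power: "0 < i \<Longrightarrow> absval (\<theta> ^ (q ^ i) - \<theta>) = real q ^ (q ^ i)"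
proof -
  assume "0 < i"
  then have "q ^ 1 < q ^ (q ^ i)"
    using q_ge_2 q_le_q_power[of i] by (intro power_strict_increasing) linarith+
  then have "absval \<theta> < absval (\<theta> ^ (q ^ i))"
    by (simp add: absval_power absval_theta flip: of_nat_power)
  then have "absval (\<theta> ^ (q ^ i) + - \<theta>) = absval (\<theta> ^ (q ^ i))"
    by (intro absval_add_eq) simp
  then show ?thesis
    by (simp add: absval_power absval_theta)
qed

lemma theta_power_neq_theta: "2 \<le> n \<Longrightarrow> \<theta> ^ n \<noteq> \<theta>"
proof
  assume "2 \<le> n" "\<theta> ^ n = \<theta>"
  then have "real q ^ n = real q ^ 1"
    by (metis absval_power absval_theta power_one_right)
  with \<open>2 \<le> n\<close> q_ge_2 show False
    by (subst (asm) power_inject_exp) auto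
qed

lemma theta_q_power_neq_theta [simp]: "\<theta> ^ (q ^ Suc i) \<noteq> \<theta>" "\<theta> ^ (q * q ^ i) \<noteq> \<theta>"
  using theta_power_neq_theta[OF order_trans[OF q_ge_2 q_le_q_power[of "Suc i"]]] by simp_all

lemma theta_nonzero [simp]: "\<theta> \<noteq> 0"
  using absval_theta q_pos(1) by (metis absval_0 neq0_conv of_nat_0_eq_iff)

subsection \<open>Power series in the Frobenius powers of a variable\<close>

text \<open>For an ultrametric absolute value, null terms at every radius amount to convergence
  everywhere. The radius 1 also gives boundedness of the coefficients.\<close>

definition entire_coeffs :: "(nat \<Rightarrow> 'a) \<Rightarrow> bool" where
  "entire_coeffs c \<longleftrightarrow> (\<forall>R\<ge>0. (\<lambda>i. absval (c i) * R ^ (q ^ i)) \<longlonglongrightarrow> 0)"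

definition tau_val :: "(nat \<Rightarrow> 'a) \<Rightarrow> 'a \<Rightarrow> 'a" where
  "tau_val c z = (\<Sum>i. c i * z ^ (q ^ i))"

text \<open>Links coefficient sequences indexed by powers of \<tau> with the ordinary power series
  of the definitions. The description picks a unique exponent since q is at least 2.\<close>

definition tau_fps :: "(nat \<Rightarrow> 'a) \<Rightarrow> 'a fps" where
  "tau_fps c = Abs_fps (\<lambda>n. if n \<in> range (\<lambda>i. q ^ i) then c (THE i. n = q ^ i) else 0)"

text \<open>Left multiplication by \<tau>: the q-th power of c z^(q^j) is c^q z^(q^(j+1)), which
  moves the coefficient up by one index.\<close>

definition frob_shift :: "(nat \<Rightarrow> 'a) \<Rightarrow> nat \<Rightarrow> 'a" where
  "frob_shift c i = (case i of 0 \<Rightarrow> 0 | Suc j \<Rightarrow> c j ^ q)"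

lemma frob_shift_simps [simp]: "frob_shift c 0 = 0" "frob_shift c (Suc j) = c j ^ q"
  by (simp_all add: frob_shift_def)

lemma tau_fps_nth_power [simp]: "fps_nth (tau_fps c) (q ^ i) = c i"
  by (auto simp: tau_fps_def)

lemma tau_fps_nth_1 [simp]: "fps_nth (tau_fps c) (Suc 0) = c 0"
  using tau_fps_nth_power[of c 0] by simp

lemma tau_fps_nth_eq_0: "n \<notin> range (\<lambda>i. q ^ i) \<Longrightarrow> fps_nth (tau_fps c) n = 0"
  by (simp add: tau_fps_def)

lemma tau_fps_eqI:
  assumes "\<And>i. fps_nth f (q ^ i) = c i" "\<And>n. n \<notin> range (\<lambda>i. q ^ i) \<Longrightarrow> fps_nth f n = 0"
  shows "f = tau_fps c"
proof (rule fps_ext)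
  show "fps_nth f n = fps_nth (tau_fps c) n" for n
    using assms tau_fps_nth_eq_0 by (cases "n \<in> range (\<lambda>i. q ^ i)") auto
qed

lemma tau_fps_power_q: "tau_fps c ^ q = tau_fps (frob_shift c)"
proof (rule tau_fps_eqI)
  fix i
  show "fps_nth (tau_fps c ^ q) (q ^ i) = frob_shift c i"
  proof (cases i)
    case 0
    have "q \<noteq> 1" using q_ge_2 by simp
    with 0 show ?thesis by (simp add: fps_nth_power_q)
  qed (simp add: fps_nth_power_q)
next
  fix n assume n: "n \<notin> range (\<lambda>i. q ^ i)"
  show "fps_nth (tau_fps c ^ q) n = 0"
  proof (cases "q dvd n")
    case True
    then obtain k where k: "n = q * k" by auto
    have "k \<notin> range (\<lambda>i. q ^ i)"
    proof
      assume "k \<in> range (\<lambda>i. q ^ i)"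
      then obtain i where "k = q ^ i" by auto
      then have "n = q ^ Suc i" by (simp add: k)
      with n show False by blast
    qed
    then show ?thesis
      by (simp add: fps_nth_power_q k tau_fps_nth_eq_0)
  qed (simp add: fps_nth_power_q)
qed

lemma fps_value_tau_fps: "fps_value (tau_fps c) z = tau_val c z"
proof -
  have "(\<Sum>i. fps_nth (tau_fps c) (q ^ i) * z ^ (q ^ i)) = (\<Sum>n. fps_nth (tau_fps c) n * z ^ n)"
    using strict_mono_q_power by (rule suminf_mono_reindex) (simp add: tau_fps_nth_eq_0)
  then show ?thesis
    by (simp add: fps_value_def tau_val_def)
qed

lemma entire_coeffs_null:
  "entire_coeffs c \<Longrightarrow> (\<lambda>i. absval (c i * z ^ (q ^ i))) \<longlonglongrightarrow> 0"
  unfolding entire_coeffs_def by (simp add: absval_mult absval_power)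

lemma tau_val_sums: "entire_coeffs c \<Longrightarrow> (\<lambda>i. c i * z ^ (q ^ i)) sums tau_val c z"
  unfolding tau_val_def
  by (intro summable_sums summable_if_absval_null entire_coeffs_null)

lemma tau_val_add:
  assumes "entire_coeffs c"
  shows "tau_val c (x + y) = tau_val c x + tau_val c y"
proof -
  have "(\<lambda>i. c i * (x + y) ^ (q ^ i)) sums (tau_val c x + tau_val c y)"
    using sums_add[OF tau_val_sums tau_val_sums, OF assms assms, of x y]
    by (simp add: frob_power_add distrib_left)
  then show ?thesis
    using tau_val_sums[OF assms] sums_unique2 by blast
qed

lemma tau_val_diff: "entire_coeffs c \<Longrightarrow> tau_val c (x - y) = tau_val c x - tau_val c y"
  using tau_val_add[of c "x - y" y] by simp

lemma tau_val_scale: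
  assumes "entire_coeffs c" "a \<in> F"
  shows "tau_val c (a * x) = a * tau_val c x"
proof -
  have "(\<lambda>i. c i * (a * x) ^ (q ^ i)) sums (a * tau_val c x)"
    using sums_cmult[OF tau_val_sums[OF assms(1)], of a x]
    by (simp add: power_mult_distrib frob_power_F[OF assms(2)] mult.left_commute)
  then show ?thesis
    using tau_val_sums[OF assms(1)] sums_unique2 by blast
qed

lemma tau_val_theta: "tau_val c (\<theta> * z) = tau_val (\<lambda>i. \<theta> ^ (q ^ i) * c i) z"
  by (simp add: tau_val_def power_mult_distrib mult_ac)

lemma entire_coeffs_cmult: "entire_coeffs c \<Longrightarrow> entire_coeffs (\<lambda>i. a * c i)"
  unfolding entire_coeffs_def
  by (auto simp: absval_mult mult.assoc intro!: tendsto_mult_right_zero)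

lemma entire_coeffs_add:
  assumes "entire_coeffs c" "entire_coeffs d"
  shows "entire_coeffs (\<lambda>i. c i + d i)"
  unfolding entire_coeffs_def
proof (intro allI impI)
  fix R :: real assume "0 \<le> R"
  have "(\<lambda>i. absval (c i) * R ^ (q ^ i) + absval (d i) * R ^ (q ^ i)) \<longlonglongrightarrow> 0"
    using assms \<open>0 \<le> R\<close> unfolding entire_coeffs_def by (intro tendsto_add_zero) auto
  moreover have "absval (c i + d i) * R ^ (q ^ i) \<le> absval (c i) * R ^ (q ^ i) + absval (d i) * R ^ (q ^ i)" for i
  proof -
    have "absval (c i + d i) \<le> absval (c i) + absval (d i)"
      by (intro absval_add_le) auto
    then show ?thesis
      using \<open>0 \<le> R\<close> by (simp add: mult_right_mono flip: distrib_right)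
  qed
  ultimately show "(\<lambda>i. absval (c i + d i) * R ^ (q ^ i)) \<longlonglongrightarrow> 0"
    using \<open>0 \<le> R\<close> by (elim null_if_le_null) auto
qed

lemma entire_coeffs_frob_shift:
  assumes "entire_coeffs c"
  shows "entire_coeffs (frob_shift c)"
  unfolding entire_coeffs_def
proof (intro allI impI)
  fix R :: real assume "0 \<le> R"
  have "(\<lambda>i. (absval (c i) * R ^ (q ^ i)) ^ q) \<longlonglongrightarrow> 0 ^ q"
    using assms \<open>0 \<le> R\<close> unfolding entire_coeffs_def by (intro tendsto_power) auto
  then have "(\<lambda>i. absval (frob_shift c (Suc i)) * R ^ (q ^ Suc i)) \<longlonglongrightarrow> 0"
    by (simp add: absval_power power_mult_distrib mult.commute flip: power_mult)
  then show "(\<lambda>i. absval (frob_shift c i) * R ^ (q ^ i)) \<longlonglongrightarrow> 0"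
    by (subst (asm) filterlim_sequentially_Suc)
qed

lemma tau_val_add_coeffs:
  assumes "entire_coeffs c" "entire_coeffs d"
  shows "tau_val (\<lambda>i. c i + d i) z = tau_val c z + tau_val d z"
proof (rule sums_unique2)
  show "(\<lambda>i. (c i + d i) * z ^ (q ^ i)) sums tau_val (\<lambda>i. c i + d i) z"
    using assms by (intro tau_val_sums entire_coeffs_add)
  show "(\<lambda>i. (c i + d i) * z ^ (q ^ i)) sums (tau_val c z + tau_val d z)"
    using sums_add[OF tau_val_sums tau_val_sums, OF assms, of z z] by (simp add: distrib_right)
qed

lemma tau_val_cmult_coeffs:
  assumes "entire_coeffs c"
  shows "tau_val (\<lambda>i. a * c i) z = a * tau_val c z"
proof (rule sums_unique2)
  show "(\<lambda>i. (a * c i) * z ^ (q ^ i)) sums tau_val (\<lambda>i. a * c i) z"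
    using assms by (intro tau_val_sums entire_coeffs_cmult)
  show "(\<lambda>i. (a * c i) * z ^ (q ^ i)) sums (a * tau_val c z)"
    using sums_cmult[OF tau_val_sums[OF assms], of a z] by (simp add: mult.assoc)
qed

lemma tau_val_frob_shift:
  assumes "entire_coeffs c"
  shows "tau_val (frob_shift c) z = tau_val c z ^ q"
proof (rule sums_unique2)
  show "(\<lambda>i. frob_shift c i * z ^ (q ^ i)) sums tau_val (frob_shift c) z"
    using assms by (intro tau_val_sums entire_coeffs_frob_shift)
  have "(\<lambda>i. (c i * z ^ (q ^ i)) ^ q) sums (tau_val c z ^ q)"
    by (rule additive_sums[OF tau_val_sums[OF assms], where h = "\<lambda>x. x ^ q" and K = 1 and k = q])
      (simp_all add: frob_add absval_power)
  then have "(\<lambda>i. frob_shift c (Suc i) * z ^ (q ^ Suc i)) sums (tau_val c z ^ q)"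
    by (simp add: power_mult_distrib mult.commute flip: power_mult)
  then show "(\<lambda>i. frob_shift c i * z ^ (q ^ i)) sums (tau_val c z ^ q)"
    by (subst sums_Suc_tail[symmetric]) simp
qed

text \<open>After z itself the next power that occurs is z^q, and the coefficients are bounded
  because the series converges at radius 1.\<close>

lemma tau_val_order:
  assumes "entire_coeffs c"
  shows "order_at_zero q (\<lambda>z. tau_val c z - c 0 * z)"
proof -
  have "(\<lambda>i. absval (c i)) \<longlonglongrightarrow> 0"
    using assms unfolding entire_coeffs_def by (auto dest: spec[of _ 1])
  then have "Bseq (\<lambda>i. absval (c i))"
    by (intro convergent_imp_Bseq) (auto simp: convergent_def)
  then obtain C where C: "0 < C" "\<And>i. absval (c i) \<le> C"
    unfolding Bseq_def by auto
  show ?thesis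
  proof (rule order_at_zeroI)
    fix z :: 'a assume z: "absval z \<le> 1"
    have "(\<lambda>i. c (Suc i) * z ^ (q ^ Suc i)) sums (tau_val c z - c 0 * z)"
      using tau_val_sums[OF assms, of z] by (subst (asm) sums_Suc_tail[symmetric]) simp
    then show "absval (tau_val c z - c 0 * z) \<le> C * absval z ^ q"
    proof (rule absval_sums_le)
      fix i
      have "absval (c (Suc i)) * absval z ^ (q ^ Suc i) \<le> C * absval z ^ q"
        using C z q_le_q_power[of "Suc i"] by (intro mult_mono power_decreasing) auto
      then show "absval (c (Suc i) * z ^ (q ^ Suc i)) \<le> C * absval z ^ q"
        by (simp add: absval_mult absval_power)
    qed (use C in auto)
  qed simp
qed

subsection \<open>Growth of coefficients\<close>

text \<open>The square root makes the bound exactly self-reproducing under the \<open>\<Delta>\<close>-step of the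
  recursion for the exponential, \<open>x \<mapsto> x ^ (q ^ 2) / \<theta> ^ (q ^ (n + 2))\<close>.\<close>

definition growth :: "real \<Rightarrow> nat \<Rightarrow> real" where
  "growth B n = (B / sqrt (real q) ^ n) ^ (q ^ n)"

lemma growth_nonneg: "0 \<le> B \<Longrightarrow> 0 \<le> growth B n"
  by (simp add: growth_def)

lemma growth_0 [simp]: "growth B 0 = B"
  by (simp add: growth_def)

lemma sqrt_q_gt_1: "1 < sqrt (real q)"
  using q_ge_2 by simp

text \<open>A step by one index divides the base by q where the bound asks only for its square root,
  so this step has room to spare.\<close>

lemma growth_power_le:
  assumes "0 \<le> B"
  shows "growth B n ^ q / real q ^ (q ^ Suc n) \<le> growth B (Suc n)"
proof -
  have "sqrt (real q) \<le> real q"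
    using sqrt_q_gt_1 q_ge_2 by (metis less_imp_le mult_left_mono mult.right_neutral of_nat_0_le_iff
        real_sqrt_ge_zero real_sqrt_mult_self abs_of_nat)
  then have "sqrt (real q) ^ n * sqrt (real q) \<le> sqrt (real q) ^ n * real q"
    by (intro mult_left_mono) auto
  then have "B / (sqrt (real q) ^ n * real q) \<le> B / (sqrt (real q) ^ n * sqrt (real q))"
    using assms sqrt_q_gt_1 by (intro divide_left_mono) auto
  moreover have "growth B n ^ q / real q ^ (q ^ Suc n) = (B / (sqrt (real q) ^ n * real q)) ^ (q ^ Suc n)"
    by (simp add: growth_def power_divide power_mult_distrib mult_ac flip: power_mult)
  ultimately show ?thesis
    using assms by (simp add: growth_def power_mono mult.commute)
qed

lemma growth_power2: "growth B n ^ (q ^ 2) / real q ^ (q ^ Suc (Suc n)) = growth B (Suc (Suc n))"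
proof -
  have "sqrt (real q) ^ Suc (Suc n) = sqrt (real q) ^ n * real q"
    by simp
  moreover have "growth B n ^ (q ^ 2) / real q ^ (q ^ Suc (Suc n))
      = (B / (sqrt (real q) ^ n * real q)) ^ (q ^ Suc (Suc n))"
    by (simp add: growth_def power_divide power_mult_distrib power2_eq_square mult_ac
        flip: power_mult del: real_sqrt_power)
  ultimately show ?thesis
    by (simp only: growth_def)
qed

text \<open>The base \<open>?y n\<close> tends to 0; once it is below 1, raising it to the power
  \<open>q ^ n\<close> only makes it smaller.\<close>

lemma growth_times_power_null:
  assumes "0 \<le> B" "0 \<le> R"
  shows "(\<lambda>n. growth B n * R ^ (q ^ n)) \<longlonglongrightarrow> 0"
proof -
  let ?y = "\<lambda>n. B * R / sqrt (real q) ^ n"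
  have lim: "?y \<longlonglongrightarrow> 0"
    using tendsto_mult[OF tendsto_const[of "B * R"] LIMSEQ_inverse_realpow_zero[OF sqrt_q_gt_1]]
    by (simp add: divide_inverse)
  have "\<forall>\<^sub>F n in sequentially. growth B n * R ^ (q ^ n) \<le> ?y n"
  proof (rule eventually_mono)
    show "\<forall>\<^sub>F n in sequentially. ?y n < 1"
      using lim by (rule order_tendstoD) simp
    fix n assume "?y n < 1"
    then have "?y n ^ (q ^ n) \<le> ?y n ^ 1"
      using assms by (intro power_decreasing) (auto simp: Suc_le_eq)
    then show "growth B n * R ^ (q ^ n) \<le> ?y n"
      by (simp add: growth_def flip: power_mult_distrib)
  qed
  then show ?thesis
    using assms growth_nonneg by (intro tendsto_sandwich[OF _ _ tendsto_const lim]) auto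
qed

lemma entire_coeffsI:
  assumes "0 \<le> B" "\<And>n. absval (c n) \<le> K * growth B n"
  shows "entire_coeffs c"
  unfolding entire_coeffs_def
proof (intro allI impI)
  fix R :: real assume "0 \<le> R"
  have "(\<lambda>n. K * (growth B n * R ^ (q ^ n))) \<longlonglongrightarrow> 0"
    using assms(1) \<open>0 \<le> R\<close> by (intro tendsto_mult_right_zero growth_times_power_null)
  moreover have "absval (c n) * R ^ (q ^ n) \<le> K * (growth B n * R ^ (q ^ n))" for n
    using mult_right_mono[OF assms(2)[of n], of "R ^ (q ^ n)"] \<open>0 \<le> R\<close> by (simp add: mult.assoc)
  ultimately show "(\<lambda>n. absval (c n) * R ^ (q ^ n)) \<longlonglongrightarrow> 0"
    using \<open>0 \<le> R\<close> by (elim null_if_le_null) auto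
qed

subsection \<open>Coefficients of the exponential, the quasi-periodic function and the extension\<close>

text \<open>The recursion read off from the coefficients of z^(q^i) in e (\<theta> z) = rho_t (e z).
  Index 1 has its own clause because \<tau>^2 contributes only from index 2 on.\<close>

fun exp_coeff :: "'a \<Rightarrow> 'a \<Rightarrow> nat \<Rightarrow> 'a" where
  "exp_coeff \<kappa> \<Delta> 0 = 1"
| "exp_coeff \<kappa> \<Delta> (Suc 0) = \<kappa> / (\<theta> ^ q - \<theta>)"
| "exp_coeff \<kappa> \<Delta> (Suc (Suc n)) =
     (\<kappa> * exp_coeff \<kappa> \<Delta> (Suc n) ^ q + \<Delta> * exp_coeff \<kappa> \<Delta> n ^ (q ^ 2)) / (\<theta> ^ (q ^ Suc (Suc n)) - \<theta>)"

text \<open>At index 0 this is 0 / 0, hence 0, which is the value that vanishing to order q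
  demands.\<close>

definition qp_coeff :: "'a \<Rightarrow> 'a \<Rightarrow> nat \<Rightarrow> 'a" where
  "qp_coeff \<kappa> \<Delta> i = frob_shift (exp_coeff \<kappa> \<Delta>) i / (\<theta> ^ (q ^ i) - \<theta>)"

text \<open>Coefficients of G_\<alpha>. They are not linear in \<alpha>, since earlier coefficients
  enter through their q-th powers.\<close>

primrec ext_coeff :: "'a \<Rightarrow> 'a \<Rightarrow> 'a \<Rightarrow> nat \<Rightarrow> 'a" where
  "ext_coeff \<kappa> \<Delta> \<alpha> 0 = 0"
| "ext_coeff \<kappa> \<Delta> \<alpha> (Suc n) =
     (ext_coeff \<kappa> \<Delta> \<alpha> n ^ q + \<alpha> * exp_coeff \<kappa> \<Delta> n ^ q) / (\<theta> ^ (q ^ Suc n) - \<theta>)"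

text \<open>Free of division and valid at every index, including 0, so that both sides can be summed
  into a functional equation.\<close>

lemma exp_coeff_rec:
  "\<theta> ^ (q ^ i) * exp_coeff \<kappa> \<Delta> i = \<theta> * exp_coeff \<kappa> \<Delta> i
     + (\<kappa> * frob_shift (exp_coeff \<kappa> \<Delta>) i + \<Delta> * frob_shift (frob_shift (exp_coeff \<kappa> \<Delta>)) i)"
proof -
  have "(\<theta> ^ (q ^ i) - \<theta>) * exp_coeff \<kappa> \<Delta> i =
      \<kappa> * frob_shift (exp_coeff \<kappa> \<Delta>) i + \<Delta> * frob_shift (frob_shift (exp_coeff \<kappa> \<Delta>)) i"
  proof (cases "(\<kappa>, \<Delta>, i)" rule: exp_coeff.cases)
    case (3 \<kappa> \<Delta> n)
    then show ?thesis
      by (simp add: power2_eq_square power_mult del: power_Suc)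
  qed (use theta_q_power_neq_theta(1)[of 0] in auto)
  then show ?thesis by (simp add: algebra_simps)
qed

lemma qp_coeff_rec:
  "\<theta> ^ (q ^ i) * qp_coeff \<kappa> \<Delta> i = \<theta> * qp_coeff \<kappa> \<Delta> i + frob_shift (exp_coeff \<kappa> \<Delta>) i"
proof -
  have "(\<theta> ^ (q ^ i) - \<theta>) * qp_coeff \<kappa> \<Delta> i = frob_shift (exp_coeff \<kappa> \<Delta>) i"
    by (cases i) (simp_all add: qp_coeff_def)
  then show ?thesis by (simp add: algebra_simps)
qed

lemma ext_coeff_rec:
  "\<theta> ^ (q ^ i) * ext_coeff \<kappa> \<Delta> \<alpha> i = \<theta> * ext_coeff \<kappa> \<Delta> \<alpha> i
     + (frob_shift (ext_coeff \<kappa> \<Delta> \<alpha>) i + \<alpha> * frob_shift (exp_coeff \<kappa> \<Delta>) i)"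
proof -
  have "(\<theta> ^ (q ^ i) - \<theta>) * ext_coeff \<kappa> \<Delta> \<alpha> i =
      frob_shift (ext_coeff \<kappa> \<Delta> \<alpha>) i + \<alpha> * frob_shift (exp_coeff \<kappa> \<Delta>) i"
    by (cases i) simp_all
  then show ?thesis by (simp add: algebra_simps)
qed

text \<open>A power of exponent at least 2 absorbs two factors \<open>B\<close>: one carried on the
  left of the coefficient bounds, one that dominates \<kappa>, \<Delta> or \<alpha>.\<close>

lemma mult_power_ge:
  assumes "1 \<le> B" "0 \<le> (x :: real)" "2 \<le> k"
  shows "B * (B * x ^ k) \<le> (B * x) ^ k"
proof -
  have "B ^ 2 \<le> B ^ k"
    using assms by (intro power_increasing) auto
  then have "B ^ 2 * x ^ k \<le> B ^ k * x ^ k"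
    using assms by (intro mult_right_mono) auto
  then show ?thesis
    by (simp add: power2_eq_square power_mult_distrib mult.assoc)
qed

text \<open>The extra factor \<open>B\<close> on the left keeps the bound stable: each step brings
  in a coefficient of size at most \<open>B\<close>, which \<open>mult_power_ge\<close> absorbs. Two
  consecutive indices are carried because the recursion has order two.\<close>

lemma exp_coeff_bound:
  assumes B: "1 \<le> B" "absval \<kappa> \<le> B" "absval \<Delta> \<le> B"
  shows "B * absval (exp_coeff \<kappa> \<Delta> n) \<le> growth B n"
proof -
  have first: "B * (absval \<kappa> * absval x ^ q / real q ^ (q ^ Suc n)) \<le> growth B (Suc n)"
    if "B * absval x \<le> growth B n" for x n
  proof -
    have "B * (absval \<kappa> * absval x ^ q) \<le> B * (B * absval x ^ q)"
      using B by (intro mult_left_mono mult_right_mono) auto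
    also have "\<dots> \<le> (B * absval x) ^ q"
      using B q_ge_2 by (intro mult_power_ge) auto
    also have "\<dots> \<le> growth B n ^ q"
      using that B by (intro power_mono) auto
    finally have "B * (absval \<kappa> * absval x ^ q) / real q ^ (q ^ Suc n)
        \<le> growth B n ^ q / real q ^ (q ^ Suc n)"
      by (intro divide_right_mono) auto
    also have "\<dots> \<le> growth B (Suc n)"
      using B by (intro growth_power_le) auto
    finally show ?thesis by simp
  qed
  have second: "B * (absval \<Delta> * absval x ^ (q ^ 2) / real q ^ (q ^ Suc (Suc n))) \<le> growth B (Suc (Suc n))"
    if "B * absval x \<le> growth B n" for x n
  proof -
    have "2 \<le> q ^ 2"
      using q_ge_2 q_le_q_power[of 2] by linarith
    have "B * (absval \<Delta> * absval x ^ (q ^ 2)) \<le> B * (B * absval x ^ (q ^ 2))"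
      using B by (intro mult_left_mono mult_right_mono) auto
    also have "\<dots> \<le> (B * absval x) ^ (q ^ 2)"
      using B \<open>2 \<le> q ^ 2\<close> by (intro mult_power_ge) auto
    also have "\<dots> \<le> growth B n ^ (q ^ 2)"
      using that B by (intro power_mono) auto
    finally have "B * (absval \<Delta> * absval x ^ (q ^ 2)) / real q ^ (q ^ Suc (Suc n))
        \<le> growth B n ^ (q ^ 2) / real q ^ (q ^ Suc (Suc n))"
      by (intro divide_right_mono) auto
    then show ?thesis
      unfolding growth_power2 by simp
  qed
  have "B * absval (exp_coeff \<kappa> \<Delta> n) \<le> growth B n \<and>
      B * absval (exp_coeff \<kappa> \<Delta> (Suc n)) \<le> growth B (Suc n)"
  proof (induction n)
    case 0
    show ?case
      \<comment> \<open>The coefficient at index 1 is the \<kappa>-step applied to the initial value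
        1.\<close>
      using first[of 1 0] absval_theta_power[of 1] by (simp add: absval_divide)
  next
    case (Suc n)
    let ?Q = "real q ^ (q ^ Suc (Suc n))"
    have "absval (exp_coeff \<kappa> \<Delta> (Suc (Suc n))) =
        absval (\<kappa> * exp_coeff \<kappa> \<Delta> (Suc n) ^ q + \<Delta> * exp_coeff \<kappa> \<Delta> n ^ (q ^ 2)) / ?Q"
      using absval_theta_power[of "Suc (Suc n)"] by (simp add: absval_divide)
    also have "\<dots> \<le> max (absval \<kappa> * absval (exp_coeff \<kappa> \<Delta> (Suc n)) ^ q)
        (absval \<Delta> * absval (exp_coeff \<kappa> \<Delta> n) ^ (q ^ 2)) / ?Q"
      using absval_ultrametric[of "\<kappa> * exp_coeff \<kappa> \<Delta> (Suc n) ^ q" "\<Delta> * exp_coeff \<kappa> \<Delta> n ^ (q ^ 2)"]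
      by (intro divide_right_mono) (auto simp: absval_mult absval_power)
    finally have "B * absval (exp_coeff \<kappa> \<Delta> (Suc (Suc n))) \<le> B * (max (absval \<kappa> * absval (exp_coeff \<kappa> \<Delta> (Suc n)) ^ q)
        (absval \<Delta> * absval (exp_coeff \<kappa> \<Delta> n) ^ (q ^ 2)) / ?Q)"
      using B by (intro mult_left_mono) auto
    also have "\<dots> \<le> growth B (Suc (Suc n))"
      using first[of "exp_coeff \<kappa> \<Delta> (Suc n)" "Suc n"] second[of "exp_coeff \<kappa> \<Delta> n" n] Suc
      by (cases "absval \<kappa> * absval (exp_coeff \<kappa> \<Delta> (Suc n)) ^ q \<le> absval \<Delta> * absval (exp_coeff \<kappa> \<Delta> n) ^ (q ^ 2)")
        (simp_all only: max_def if_True if_False simp_thms)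
    finally show ?case using Suc by blast
  qed
  then show ?thesis ..
qed

text \<open>The parameter \<open>a\<close> records how small \<alpha> is: \<open>a = 1\<close>
  yields convergence, and \<open>a = absval \<alpha>\<close> yields the behaviour of G_\<alpha> as
  \<alpha> tends to 0. The induction closes because \<open>a \<le> 1\<close> gives a^q \<le>
  a.\<close>

lemma ext_coeff_bound:
  assumes B: "1 \<le> B" "absval \<kappa> \<le> B" "absval \<Delta> \<le> B"
    and a: "0 \<le> a" "a \<le> 1" "absval \<alpha> \<le> a * B"
  shows "B * absval (ext_coeff \<kappa> \<Delta> \<alpha> n) \<le> a * growth B n"
proof (induction n)
  case 0
  then show ?case using a B by simp
next
  case (Suc n)
  let ?e = "absval (exp_coeff \<kappa> \<Delta> n)" and ?g = "absval (ext_coeff \<kappa> \<Delta> \<alpha> n)"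
    and ?Q = "real q ^ (q ^ Suc n)"
  have "B * ?g ^ q \<le> (B * ?g) ^ q"
    using order_trans[OF mult_right_mono[of 1 B "B * ?g ^ q"] mult_power_ge[of B ?g q]] B q_ge_2
    by simp
  also have "\<dots> \<le> (a * growth B n) ^ q"
    using Suc B by (intro power_mono) auto
  also have "\<dots> \<le> a * growth B n ^ q"
    using a B power_decreasing[of 1 q a]
    by (simp add: power_mult_distrib mult_right_mono growth_nonneg)
  finally have 1: "B * ?g ^ q \<le> a * growth B n ^ q" .
  have "B * (absval \<alpha> * ?e ^ q) \<le> B * (a * B * ?e ^ q)"
    using a B by (intro mult_left_mono mult_right_mono) auto
  also have "\<dots> = a * (B * (B * ?e ^ q))"
    by (simp add: mult_ac)
  also have "\<dots> \<le> a * (B * ?e) ^ q"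
    using a B q_ge_2 by (intro mult_left_mono mult_power_ge) auto
  also have "\<dots> \<le> a * growth B n ^ q"
    using a B exp_coeff_bound[OF B] by (intro mult_left_mono power_mono) auto
  finally have 2: "B * (absval \<alpha> * ?e ^ q) \<le> a * growth B n ^ q" .
  have "B * absval (ext_coeff \<kappa> \<Delta> \<alpha> n ^ q + \<alpha> * exp_coeff \<kappa> \<Delta> n ^ q) \<le> a * growth B n ^ q"
  proof -
    have "absval (ext_coeff \<kappa> \<Delta> \<alpha> n ^ q + \<alpha> * exp_coeff \<kappa> \<Delta> n ^ q) \<le> a * growth B n ^ q / B"
      using 1 2 B by (intro absval_add_le) (auto simp: absval_mult absval_power field_simps)
    then show ?thesis using B by (simp add: field_simps)
  qed
  then have "B * absval (ext_coeff \<kappa> \<Delta> \<alpha> n ^ q + \<alpha> * exp_coeff \<kappa> \<Delta> n ^ q) / ?Q \<le> a * growth B n ^ q / ?Q"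
    by (intro divide_right_mono) auto
  also have "\<dots> \<le> a * growth B (Suc n)"
    using mult_left_mono[OF growth_power_le[of B n], of a] a B by simp
  finally show ?case
    using absval_theta_power[of "Suc n"] by (simp add: absval_divide)
qed

lemma entire_exp_coeff: "entire_coeffs (exp_coeff \<kappa> \<Delta>)"
proof -
  define B where "B = 1 + absval \<kappa> + absval \<Delta>"
  have B: "1 \<le> B" "absval \<kappa> \<le> B" "absval \<Delta> \<le> B"
    by (auto simp: B_def)
  show ?thesis
  proof (rule entire_coeffsI[of B])
    show "absval (exp_coeff \<kappa> \<Delta> n) \<le> 1 * growth B n" for n
      using exp_coeff_bound[OF B, of n] mult_right_mono[OF B(1), of "absval (exp_coeff \<kappa> \<Delta> n)"] by simp
  qed (use B in simp)
qed

lemma entire_ext_coeff: "entire_coeffs (ext_coeff \<kappa> \<Delta> \<alpha>)"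
proof -
  define B where "B = 1 + absval \<kappa> + absval \<Delta> + absval \<alpha>"
  have B: "1 \<le> B" "absval \<kappa> \<le> B" "absval \<Delta> \<le> B" "absval \<alpha> \<le> 1 * B"
    by (auto simp: B_def)
  show ?thesis
  proof (rule entire_coeffsI[of B])
    show "absval (ext_coeff \<kappa> \<Delta> \<alpha> n) \<le> 1 * growth B n" for n
      using ext_coeff_bound[OF B(1-3) _ _ B(4), of n]
        mult_right_mono[OF B(1), of "absval (ext_coeff \<kappa> \<Delta> \<alpha> n)"] by simp
  qed (use B in simp)
qed

lemma absval_theta_power_ge_1: "0 < i \<Longrightarrow> 1 \<le> absval (\<theta> ^ (q ^ i) - \<theta>)"
  by (simp add: absval_theta_power)

lemma entire_qp_coeff: "entire_coeffs (qp_coeff \<kappa> \<Delta>)"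
  unfolding entire_coeffs_def
proof (intro allI impI)
  fix R :: real assume R: "0 \<le> R"
  have "absval (qp_coeff \<kappa> \<Delta> i) \<le> absval (frob_shift (exp_coeff \<kappa> \<Delta>) i)" for i
  proof (cases i)
    case (Suc n)
    then show ?thesis
      using divide_left_mono[OF absval_theta_power_ge_1[of i], of "absval (exp_coeff \<kappa> \<Delta> n ^ q)"]
      by (simp add: qp_coeff_def absval_divide)
  qed (simp add: qp_coeff_def)
  then have "absval (qp_coeff \<kappa> \<Delta> i) * R ^ (q ^ i) \<le> absval (frob_shift (exp_coeff \<kappa> \<Delta>) i) * R ^ (q ^ i)" for i
    using R by (intro mult_right_mono) auto
  moreover have "(\<lambda>i. absval (frob_shift (exp_coeff \<kappa> \<Delta>) i) * R ^ (q ^ i)) \<longlonglongrightarrow> 0"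
    using entire_coeffs_frob_shift[OF entire_exp_coeff] R unfolding entire_coeffs_def by blast
  ultimately show "(\<lambda>i. absval (qp_coeff \<kappa> \<Delta> i) * R ^ (q ^ i)) \<longlonglongrightarrow> 0"
    using R by (elim null_if_le_null) auto
qed

text \<open>For fixed z, F_tau (z) is the derivative of G_\<alpha> (z) with respect to \<alpha> at
  0: what remains is built from q-th powers of coefficients that are themselves O(\<alpha>). The
  constant depends on z but not on \<alpha>.\<close>

lemma ext_val_order_alpha:
  "order_at_zero q (\<lambda>\<alpha>. tau_val (ext_coeff \<kappa> \<Delta> \<alpha>) z - \<alpha> * tau_val (qp_coeff \<kappa> \<Delta>) z)"
proof -
  define B where "B = 1 + absval \<kappa> + absval \<Delta>"
  have B: "1 \<le> B" "absval \<kappa> \<le> B" "absval \<Delta> \<le> B"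
    by (auto simp: B_def)
  have "Bseq (\<lambda>n. growth B n * absval z ^ (q ^ n))"
    using B growth_times_power_null[of B "absval z"]
    by (intro convergent_imp_Bseq) (auto simp: convergent_def)
  then obtain C where C: "0 < C" "\<And>n. growth B n * absval z ^ (q ^ n) \<le> C"
    unfolding Bseq_def by (auto simp: abs_le_iff)
  show ?thesis
  proof (rule order_at_zeroI)
    fix \<alpha> :: 'a assume \<alpha>: "absval \<alpha> \<le> 1"
    \<comment> \<open>The subtraction removes the summand with \<alpha> from the recursion, so
      \<open>\<delta> (Suc n)\<close> is the q-th power of
      \<open>ext_coeff \<kappa> \<Delta> \<alpha> n\<close> over the denominator.\<close>
    define \<delta> where "\<delta> i = ext_coeff \<kappa> \<Delta> \<alpha> i + - \<alpha> * qp_coeff \<kappa> \<Delta> i" for i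
    have \<delta>: "absval (\<delta> i) \<le> absval \<alpha> ^ q * growth B i" for i
    proof (cases i)
      case 0
      then show ?thesis using B by (simp add: \<delta>_def qp_coeff_def)
    next
      case (Suc n)
      let ?g = "absval (ext_coeff \<kappa> \<Delta> \<alpha> n)"
      have "absval \<alpha> \<le> absval \<alpha> * B"
        using mult_left_mono[OF B(1), of "absval \<alpha>"] by simp
      then have "B * ?g \<le> absval \<alpha> * growth B n"
        using \<alpha> B by (intro ext_coeff_bound) auto
      then have "?g \<le> absval \<alpha> * growth B n"
        using mult_right_mono[OF B(1), of ?g] by simp
      then have "?g ^ q \<le> (absval \<alpha> * growth B n) ^ q"
        by (intro power_mono) auto
      then have "?g ^ q / real q ^ (q ^ Suc n) \<le> (absval \<alpha> * growth B n) ^ q / real q ^ (q ^ Suc n)"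
        by (intro divide_right_mono) auto
      also have "\<dots> \<le> absval \<alpha> ^ q * growth B (Suc n)"
        using mult_left_mono[OF growth_power_le[of B n], of "absval \<alpha> ^ q"] B
        by (simp add: power_mult_distrib)
      finally show ?thesis
        using absval_theta_power[of "Suc n"]
        by (simp add: Suc \<delta>_def qp_coeff_def absval_divide absval_power flip: diff_divide_distrib)
    qed
    have "entire_coeffs \<delta>"
      unfolding \<delta>_def by (intro entire_coeffs_add entire_coeffs_cmult entire_ext_coeff entire_qp_coeff)
    have "tau_val \<delta> z = tau_val (ext_coeff \<kappa> \<Delta> \<alpha>) z - \<alpha> * tau_val (qp_coeff \<kappa> \<Delta>) z"
      unfolding \<delta>_def
      by (subst tau_val_add_coeffs, simp_all only: tau_val_cmult_coeffs entire_coeffs_cmult entire_ext_coeff entire_qp_coeff)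
        simp
    moreover have "absval (tau_val \<delta> z) \<le> C * absval \<alpha> ^ q"
      using tau_val_sums[OF \<open>entire_coeffs \<delta>\<close>, of z]
    proof (rule absval_sums_le)
      fix n
      have "absval (\<delta> n * z ^ (q ^ n)) \<le> absval \<alpha> ^ q * (growth B n * absval z ^ (q ^ n))"
        using mult_right_mono[OF \<delta>[of n], of "absval z ^ (q ^ n)"]
        by (simp add: absval_mult absval_power mult.assoc)
      also have "\<dots> \<le> absval \<alpha> ^ q * C"
        using C by (intro mult_left_mono) auto
      finally show "absval (\<delta> n * z ^ (q ^ n)) \<le> C * absval \<alpha> ^ q"
        by (simp add: mult.commute)
    qed (use C in auto)
    ultimately show "absval (tau_val (ext_coeff \<kappa> \<Delta> \<alpha>) z - \<alpha> * tau_val (qp_coeff \<kappa> \<Delta>) z) \<le> C * absval \<alpha> ^ q"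
      by simp
  qed simp
qed

subsection \<open>Identification of the exponential and quasi-periodic series\<close>

lemma tau_fps_power_q2: "tau_fps c ^ (q ^ 2) = tau_fps (frob_shift (frob_shift c))"
  by (simp add: power2_eq_square power_mult tau_fps_power_q)

lemma exp_coeff_unique:
  assumes "c 0 = 1"
    and rec: "\<And>i. \<theta> ^ (q ^ i) * c i =
      \<theta> * c i + \<kappa> * frob_shift c i + \<Delta> * frob_shift (frob_shift c) i"
  shows "c = exp_coeff \<kappa> \<Delta>"
proof
  fix i
  show "c i = exp_coeff \<kappa> \<Delta> i"
  proof (induction i rule: less_induct)
    case (less i)
    show ?case
    proof (cases i)
      case (Suc j)
      have "frob_shift c i = frob_shift (exp_coeff \<kappa> \<Delta>) i"
        by (simp add: Suc less)
      moreover have "frob_shift (frob_shift c) i = frob_shift (frob_shift (exp_coeff \<kappa> \<Delta>)) i"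
        by (cases j) (simp_all add: Suc less)
      ultimately have "(\<theta> ^ (q ^ i) - \<theta>) * c i = (\<theta> ^ (q ^ i) - \<theta>) * exp_coeff \<kappa> \<Delta> i"
        using rec[of i] exp_coeff_rec[of i \<kappa> \<Delta>] by (simp add: algebra_simps)
      then show ?thesis
        unfolding Suc by (metis mult_cancel_left right_minus_eq theta_q_power_neq_theta(1))
    qed (simp add: assms)
  qed
qed

lemma exp_series_rho_t: "exp_series q \<theta> (rho_t \<theta> \<kappa> \<Delta>) = tau_fps (exp_coeff \<kappa> \<Delta>)"
  unfolding exp_series_def
proof (rule the_equality)
  let ?E = "tau_fps (exp_coeff \<kappa> \<Delta>)"
  have "fps_compose ?E (fps_const \<theta> * fps_X) = twisted_act_fps q (rho_t \<theta> \<kappa> \<Delta>) ?E"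
  proof (rule fps_ext)
    fix n
    show "fps_nth (fps_compose ?E (fps_const \<theta> * fps_X)) n =
        fps_nth (twisted_act_fps q (rho_t \<theta> \<kappa> \<Delta>) ?E) n"
    proof (cases "n \<in> range (\<lambda>i. q ^ i)")
      case True
      then obtain i where "n = q ^ i" by auto
      then show ?thesis
        using exp_coeff_rec[of i \<kappa> \<Delta>]
        by (simp add: twisted_act_fps_rho_t tau_fps_power_q tau_fps_power_q2 add.assoc)
    next
      case False
      then show ?thesis
        by (simp add: twisted_act_fps_rho_t tau_fps_power_q tau_fps_power_q2 tau_fps_nth_eq_0)
    qed
  qed
  then show "fps_nth ?E 1 = 1 \<and> (\<forall>n. fps_nth ?E n \<noteq> 0 \<longrightarrow> (\<exists>i. n = q ^ i)) \<and>
      fps_compose ?E (fps_const \<theta> * fps_X) = twisted_act_fps q (rho_t \<theta> \<kappa> \<Delta>) ?E"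
    using tau_fps_nth_eq_0[of _ "exp_coeff \<kappa> \<Delta>"] by auto
next
  fix E
  assume E: "fps_nth E 1 = 1 \<and> (\<forall>n. fps_nth E n \<noteq> 0 \<longrightarrow> (\<exists>i. n = q ^ i)) \<and>
    fps_compose E (fps_const \<theta> * fps_X) = twisted_act_fps q (rho_t \<theta> \<kappa> \<Delta>) E"
  define c where "c = (\<lambda>i. fps_nth E (q ^ i))"
  \<comment> \<open>The condition on the support of \<open>E\<close> turns uniqueness of the series
    into uniqueness of the sequence \<open>c\<close>.\<close>
  have E_eq: "E = tau_fps c"
    using E by (intro tau_fps_eqI) (auto simp: c_def)
  have "c = exp_coeff \<kappa> \<Delta>"
  proof (rule exp_coeff_unique)
    show "c 0 = 1"
      using E by (simp add: c_def)
    fix i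
    have "fps_nth (fps_compose (tau_fps c) (fps_const \<theta> * fps_X)) (q ^ i) =
        fps_nth (twisted_act_fps q (rho_t \<theta> \<kappa> \<Delta>) (tau_fps c)) (q ^ i)"
      using E E_eq by simp
    then show "\<theta> ^ (q ^ i) * c i =
        \<theta> * c i + \<kappa> * frob_shift c i + \<Delta> * frob_shift (frob_shift c) i"
      by (simp add: twisted_act_fps_rho_t tau_fps_power_q tau_fps_power_q2)
  qed
  with E_eq show "E = tau_fps (exp_coeff \<kappa> \<Delta>)"
    by simp
qed

lemma tau_fps_nth_less:
  assumes "n < q"
  shows "fps_nth (tau_fps c) n = (if n = 1 then c 0 else 0)"
proof (cases "n \<in> range (\<lambda>i. q ^ i)")
  case True
  then obtain i where i: "n = q ^ i" by auto
  then have "i = 0"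
    using assms q_le_q_power[of i] by (cases "i = 0") auto
  with i show ?thesis by simp
next
  case False
  then have "n \<noteq> 1"
    using rangeI[of "\<lambda>i. q ^ i" 0] by auto
  with False show ?thesis by (simp add: tau_fps_nth_eq_0)
qed

text \<open>The description does not restrict the support, so uniqueness is checked at every
  exponent: below q the congruence prescribes the coefficient, from q on \<theta>^n differs from
  \<theta> and the equation determines it.\<close>

lemma quasi_periodic_series_rho_t:
  "quasi_periodic_series q \<theta> (rho_t \<theta> \<kappa> \<Delta>) = tau_fps (qp_coeff \<kappa> \<Delta>)"
  unfolding quasi_periodic_series_def exp_series_rho_t tau_fps_power_q
proof (rule the_equality)
  let ?G = "tau_fps (qp_coeff \<kappa> \<Delta>)"
  have "fps_compose ?G (fps_const \<theta> * fps_X) - fps_const \<theta> * ?G = tau_fps (frob_shift (exp_coeff \<kappa> \<Delta>))"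
  proof (rule fps_ext)
    fix n
    show "fps_nth (fps_compose ?G (fps_const \<theta> * fps_X) - fps_const \<theta> * ?G) n =
        fps_nth (tau_fps (frob_shift (exp_coeff \<kappa> \<Delta>))) n"
    proof (cases "n \<in> range (\<lambda>i. q ^ i)")
      case True
      then obtain i where "n = q ^ i" by auto
      then show ?thesis
        using qp_coeff_rec[of i \<kappa> \<Delta>] by simp
    qed (simp add: tau_fps_nth_eq_0)
  qed
  moreover have "qp_coeff \<kappa> \<Delta> 0 = 0"
    by (simp add: qp_coeff_def)
  ultimately show "(\<forall>n<q. fps_nth ?G n = 0) \<and>
      fps_compose ?G (fps_const \<theta> * fps_X) - fps_const \<theta> * ?G = tau_fps (frob_shift (exp_coeff \<kappa> \<Delta>))"
    by (auto simp: tau_fps_nth_less)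
  fix G
  assume G: "(\<forall>n<q. fps_nth G n = 0) \<and>
    fps_compose G (fps_const \<theta> * fps_X) - fps_const \<theta> * G = tau_fps (frob_shift (exp_coeff \<kappa> \<Delta>))"
  show "G = ?G"
  proof (rule fps_ext)
    fix n
    show "fps_nth G n = fps_nth ?G n"
    proof (cases "n < q")
      case True
      with G \<open>qp_coeff \<kappa> \<Delta> 0 = 0\<close> show ?thesis by (simp add: tau_fps_nth_less)
    next
      case False
      then have "\<theta> ^ n \<noteq> \<theta>"
        using q_ge_2 by (intro theta_power_neq_theta) simp
      moreover have "fps_nth (fps_compose G (fps_const \<theta> * fps_X) - fps_const \<theta> * G) n =
          fps_nth (fps_compose ?G (fps_const \<theta> * fps_X) - fps_const \<theta> * ?G) n"
        using G \<open>fps_compose ?G _ - _ = _\<close> by simp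
      then have "(\<theta> ^ n - \<theta>) * fps_nth G n = (\<theta> ^ n - \<theta>) * fps_nth ?G n"
        by (simp add: left_diff_distrib)
      ultimately show ?thesis by simp
    qed
  qed
qed

lemma drinfeld_exp_rho_t: "drinfeld_exp q \<theta> (rho_t \<theta> \<kappa> \<Delta>) = tau_val (exp_coeff \<kappa> \<Delta>)"
  by (rule ext) (simp add: drinfeld_exp_def exp_series_rho_t fps_value_tau_fps)

lemma quasi_periodic_tau_rho_t:
  "quasi_periodic_tau q \<theta> (rho_t \<theta> \<kappa> \<Delta>) = tau_val (qp_coeff \<kappa> \<Delta>)"
  by (rule ext) (simp add: quasi_periodic_tau_def quasi_periodic_series_rho_t fps_value_tau_fps)

subsection \<open>Functional equations\<close>

lemmas entire_intros = entire_coeffs_add entire_coeffs_cmult entire_coeffs_frob_shift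
  entire_exp_coeff entire_qp_coeff entire_ext_coeff

lemma exp_val_theta:
  "tau_val (exp_coeff \<kappa> \<Delta>) (\<theta> * z) = \<theta> * tau_val (exp_coeff \<kappa> \<Delta>) z
     + \<kappa> * tau_val (exp_coeff \<kappa> \<Delta>) z ^ q + \<Delta> * tau_val (exp_coeff \<kappa> \<Delta>) z ^ (q ^ 2)"
  unfolding tau_val_theta exp_coeff_rec
  by (simp add: tau_val_add_coeffs tau_val_cmult_coeffs tau_val_frob_shift entire_intros
      power2_eq_square power_mult add.assoc)

lemma qp_val_theta:
  "tau_val (qp_coeff \<kappa> \<Delta>) (\<theta> * z) = \<theta> * tau_val (qp_coeff \<kappa> \<Delta>) z + tau_val (exp_coeff \<kappa> \<Delta>) z ^ q"
  unfolding tau_val_theta qp_coeff_rec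
  by (simp add: tau_val_add_coeffs tau_val_cmult_coeffs tau_val_frob_shift entire_intros)

lemma ext_val_theta:
  "tau_val (ext_coeff \<kappa> \<Delta> \<alpha>) (\<theta> * z) = \<theta> * tau_val (ext_coeff \<kappa> \<Delta> \<alpha>) z
     + tau_val (ext_coeff \<kappa> \<Delta> \<alpha>) z ^ q + \<alpha> * tau_val (exp_coeff \<kappa> \<Delta>) z ^ q"
  unfolding tau_val_theta ext_coeff_rec
  by (simp add: tau_val_add_coeffs tau_val_cmult_coeffs tau_val_frob_shift entire_intros add.assoc)

lemma carlitz_val_theta:
  "tau_val (exp_coeff 1 0) (\<theta> * z) = \<theta> * tau_val (exp_coeff 1 0) z + tau_val (exp_coeff 1 0) z ^ q"
  by (simp add: exp_val_theta)

lemma exp_val_order: "order_at_zero q (\<lambda>z. tau_val (exp_coeff \<kappa> \<Delta>) z - z)"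
  using tau_val_order[OF entire_exp_coeff] by simp

lemma qp_val_order: "order_at_zero q (tau_val (qp_coeff \<kappa> \<Delta>))"
  using tau_val_order[OF entire_qp_coeff] by (simp add: qp_coeff_def)

lemma ext_val_order: "order_at_zero q (tau_val (ext_coeff \<kappa> \<Delta> \<alpha>))"
  using tau_val_order[OF entire_ext_coeff] by simp

lemma exp_val_order_1: "order_at_zero 1 (tau_val (exp_coeff \<kappa> \<Delta>))"
  using order_at_zero_add[OF order_at_zero_mono[OF exp_val_order] order_at_zero_ident] by simp

section \<open>Uniqueness for the Carlitz equation and its two applications\<close>

lemma q_powers_le:
  assumes "0 \<le> M"
  shows "(M / real q ^ n) ^ q \<le> M ^ q / (real q ^ 2) ^ n"
proof -
  have "(real q ^ 2) ^ n \<le> (real q ^ n) ^ q"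
    using q_ge_2 power_increasing[of "2 * n" "n * q" "real q"]
    by (simp add: mult.commute flip: power_mult)
  then show ?thesis
    using assms by (simp add: power_divide divide_left_mono)
qed

text \<open>Where |h| \<le> 1, also |h^q| \<le> |h|, so multiplication by \<theta> in the argument
  enlarges |h| at most by the factor q. This gives \<open>expansion_null\<close> with threshold 1.
  As \<open>h\<close> is an arbitrary map, the variable may be z or u.\<close>

lemma carlitz_equation_unique:
  assumes h: "\<And>z. h (\<theta> * z) = \<theta> * h z + h z ^ q" and ord: "order_at_zero q h"
  shows "h z = 0"
proof -
  obtain C where C: "\<forall>\<^sub>F x in nhds 0. absval (h x) \<le> C * absval x ^ q"
    using ord unfolding order_at_zero_def by blast
  define x where "x n = absval (h (z / \<theta> ^ n))" for n
  have "x 0 = 0"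
  proof (rule expansion_null[of "real q" 1])
    fix n assume *: "x (Suc n) \<le> 1"
    have "\<theta> * (z / \<theta> ^ Suc n) = z / \<theta> ^ n" by simp
    then have "x n = absval (\<theta> * h (z / \<theta> ^ Suc n) + h (z / \<theta> ^ Suc n) ^ q)"
      unfolding x_def by (metis h)
    also have "\<dots> \<le> real q * x (Suc n)"
    proof (rule absval_add_le)
      have "x (Suc n) ^ q \<le> x (Suc n) ^ 1"
        using * by (intro power_decreasing) (auto simp: x_def)
      also have "x (Suc n) ^ 1 \<le> real q * x (Suc n)"
        using mult_right_mono[of 1 "real q" "x (Suc n)"] by (simp add: x_def)
      finally show "absval (h (z / \<theta> ^ Suc n) ^ q) \<le> real q * x (Suc n)"
        by (simp add: x_def absval_power)
    qed (simp add: x_def absval_mult absval_theta)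
    finally show "x n \<le> real q * x (Suc n)" .
  next
    have abs_eq: "absval (z / \<theta> ^ n) = absval z / real q ^ n" for n
      by (simp add: absval_divide absval_power absval_theta)
    have "(\<lambda>n. absval z / real q ^ n) \<longlonglongrightarrow> 0"
      using tendsto_mult[OF tendsto_const LIMSEQ_inverse_realpow_zero[of "real q"], of "absval z"] q_ge_2
      by (simp add: divide_inverse)
    then have "(\<lambda>n. z / \<theta> ^ n) \<longlonglongrightarrow> 0"
      by (simp add: LIMSEQ_absval_iff abs_eq)
    then have "\<forall>\<^sub>F n in sequentially. x n \<le> C * (absval z / real q ^ n) ^ q"
      using eventually_compose_filterlim[OF C, of "\<lambda>n. z / \<theta> ^ n" sequentially]
      by (simp add: x_def abs_eq)
    then show "\<forall>\<^sub>F n in sequentially. x n \<le> (\<bar>C\<bar> * absval z ^ q) / (real q ^ 2) ^ n"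
    proof eventually_elim
      case (elim n)
      note elim
      also have "C * (absval z / real q ^ n) ^ q \<le> \<bar>C\<bar> * (absval z ^ q / (real q ^ 2) ^ n)"
        by (intro mult_mono q_powers_le) auto
      finally show ?case by simp
    qed
  qed (use q_ge_2 in \<open>auto simp: x_def\<close>)
  then show ?thesis by (simp add: x_def)
qed

text \<open>The relation for \<open>r\<close> is used twice. The q-th power of r a e^q, coming from
  A (\<theta> z)^q, cancels the e^(q^2) term of r a^q e (\<theta> z); and the summand r \<Delta>
  a^(q^2) e^q, coming from \<open>b\<close>, is the q-th power of - r a^q e, which h^q
  requires.\<close>

lemma ext_val_rho_t:
  assumes r: "r ^ q = - \<Delta> * r"
  shows "tau_val (ext_coeff \<kappa> \<Delta> (r * (\<theta> * a + \<kappa> * a ^ q + \<Delta> * a ^ (q ^ 2)))) z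
      - (\<theta> * tau_val (ext_coeff \<kappa> \<Delta> (r * a)) z + tau_val (ext_coeff \<kappa> \<Delta> (r * a)) z ^ q)
      + tau_val (exp_coeff 1 0) (r * a ^ q * z)
    = r * a ^ q * tau_val (exp_coeff \<kappa> \<Delta>) z"
proof -
  let ?e = "tau_val (exp_coeff \<kappa> \<Delta>)" and ?C = "tau_val (exp_coeff 1 0)"
  define b where "b = r * (\<theta> * a + \<kappa> * a ^ q + \<Delta> * a ^ (q ^ 2))"
  define A where "A = tau_val (ext_coeff \<kappa> \<Delta> (r * a))"
  define B where "B = tau_val (ext_coeff \<kappa> \<Delta> b)"
  define h where "h z = B z - (\<theta> * A z + A z ^ q) + (?C (r * a ^ q * z) - r * a ^ q * ?e z)" for z
  have "h z = 0"
  proof (rule carlitz_equation_unique[of h])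
    fix z
    have A: "A (\<theta> * z) = \<theta> * A z + A z ^ q + r * a * ?e z ^ q"
      and B: "B (\<theta> * z) = \<theta> * B z + B z ^ q + b * ?e z ^ q"
      by (simp_all add: A_def B_def ext_val_theta)
    have C: "?C (r * a ^ q * (\<theta> * z)) = \<theta> * ?C (r * a ^ q * z) + ?C (r * a ^ q * z) ^ q"
      using carlitz_val_theta[of "r * a ^ q * z"] by (simp add: mult_ac)
    have frob: "h z ^ q = B z ^ q - (\<theta> ^ q * A z ^ q + (A z ^ q) ^ q)
        + (?C (r * a ^ q * z) ^ q - r ^ q * (a ^ q) ^ q * ?e z ^ q)"
      unfolding h_def by (simp add: frob_add frob_diff power_mult_distrib)
    have A': "A (\<theta> * z) ^ q = \<theta> ^ q * A z ^ q + (A z ^ q) ^ q + r ^ q * a ^ q * (?e z ^ q) ^ q"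
      unfolding A by (simp add: frob_add power_mult_distrib)
    show "h (\<theta> * z) = \<theta> * h z + h z ^ q"
      unfolding frob unfolding h_def A' B C exp_val_theta unfolding A b_def r
      by (simp add: power2_eq_square power_mult algebra_simps)
  next
    have "order_at_zero 1 A"
      unfolding A_def using order_at_zero_mono[OF ext_val_order, of 1] by simp
    moreover have "order_at_zero q (\<lambda>x :: 'a. x ^ q)"
      by (rule order_at_zeroI[of 1 _ 1]) (simp_all add: absval_power)
    ultimately have Aq: "order_at_zero q (\<lambda>z. A z ^ q)"
      by (rule order_at_zero_compose[rotated])
    \<comment> \<open>Each of the two exponentials has order 1 only; their linear terms r a^q z
      agree and cancel in the difference.\<close>
    have "order_at_zero q (\<lambda>z. ?C (r * a ^ q * z) - r * a ^ q * z)"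
      by (rule order_at_zero_compose[OF exp_val_order, of "\<lambda>z. r * a ^ q * z"])
        (rule order_at_zero_cmult[OF order_at_zero_ident])
    from order_at_zero_diff[OF this order_at_zero_cmult[OF exp_val_order[of \<kappa> \<Delta>], of "r * a ^ q"]]
    have "order_at_zero q (\<lambda>z. ?C (r * a ^ q * z) - r * a ^ q * ?e z)"
      by (simp add: algebra_simps)
    moreover have "order_at_zero q (\<lambda>z. B z - (\<theta> * A z + A z ^ q))"
      unfolding B_def using Aq unfolding A_def
      by (intro order_at_zero_diff order_at_zero_add order_at_zero_cmult ext_val_order)
    ultimately show "order_at_zero q h"
      unfolding h_def by (intro order_at_zero_add)
  qed
  then show ?thesis
    unfolding h_def A_def B_def b_def by (simp add: algebra_simps)
qed

text \<open>The equation for F_tau at u produces the correction r e(u)^q omega inside the Carlitz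
  exponential. It is the same correction that \<open>ext_val_rho_t\<close> gives for a = e(u) at z =
  omega, so it drops out of the difference \<open>h\<close>.\<close>

lemma carlitz_exp_of_period_pairing:
  assumes r: "r ^ q = - \<Delta> * r" and \<omega>: "tau_val (exp_coeff \<kappa> \<Delta>) \<omega> = 0"
  shows "tau_val (exp_coeff 1 0) (r * (u * tau_val (qp_coeff \<kappa> \<Delta>) \<omega> - \<omega> * tau_val (qp_coeff \<kappa> \<Delta>) u))
    = tau_val (ext_coeff \<kappa> \<Delta> (r * tau_val (exp_coeff \<kappa> \<Delta>) u)) \<omega>"
proof -
  let ?e = "tau_val (exp_coeff \<kappa> \<Delta>)" and ?C = "tau_val (exp_coeff 1 0)"
    and ?F = "tau_val (qp_coeff \<kappa> \<Delta>)"
  define y where "y u = r * (u * ?F \<omega> - \<omega> * ?F u)" for u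
  define G where "G \<alpha> = tau_val (ext_coeff \<kappa> \<Delta> \<alpha>) \<omega>" for \<alpha>
  define h where "h u = ?C (y u) - G (r * ?e u)" for u
  have "h u = 0"
  proof (rule carlitz_equation_unique[of h])
    fix u
    have "?C (y (\<theta> * u)) = ?C (\<theta> * y u - r * ?e u ^ q * \<omega>)"
      by (simp add: y_def qp_val_theta algebra_simps)
    also have "\<dots> = \<theta> * ?C (y u) + ?C (y u) ^ q - ?C (r * ?e u ^ q * \<omega>)"
      by (simp only: tau_val_diff[OF entire_exp_coeff] carlitz_val_theta)
    finally have "?C (y (\<theta> * u)) = \<theta> * ?C (y u) + ?C (y u) ^ q - ?C (r * ?e u ^ q * \<omega>)" .
    moreover have "G (r * ?e (\<theta> * u)) = \<theta> * G (r * ?e u) + G (r * ?e u) ^ q - ?C (r * ?e u ^ q * \<omega>)"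
      using ext_val_rho_t[OF r, of \<kappa> "?e u" \<omega>]
      by (simp add: G_def \<omega> exp_val_theta[of \<kappa> \<Delta> u] algebra_simps)
    ultimately show "h (\<theta> * u) = \<theta> * h u + h u ^ q"
      unfolding h_def frob_diff by (simp add: right_diff_distrib)
  next
    \<comment> \<open>The sum is \<open>r * ?F \<omega> * ?e u - y u\<close>, so the linear term of
      G at r e(u) agrees with \<open>y u\<close> up to order q. This connects estimates 2 and
      3.\<close>
    have "order_at_zero q (\<lambda>u. r * ?F \<omega> * (?e u - u) + r * \<omega> * ?F u)"
      by (intro order_at_zero_add order_at_zero_cmult exp_val_order qp_val_order)
    then have 1: "order_at_zero q (\<lambda>u. r * ?F \<omega> * ?e u - y u)"
      by (simp add: y_def algebra_simps)
    have "order_at_zero 1 (\<lambda>u. r * ?F \<omega> * ?e u)"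
      by (intro order_at_zero_cmult exp_val_order_1)
    from order_at_zero_diff[OF this order_at_zero_mono[OF 1, of 1]]
    have "order_at_zero 1 y"
      by simp
    then have 2: "order_at_zero q (\<lambda>u. ?C (y u) - y u)"
      by (rule order_at_zero_compose[OF exp_val_order])
    have 3: "order_at_zero q (\<lambda>u. G (r * ?e u) - r * ?e u * ?F \<omega>)"
      unfolding G_def
      by (rule order_at_zero_compose[OF ext_val_order_alpha, of "\<lambda>u. r * ?e u"])
        (rule order_at_zero_cmult[OF exp_val_order_1])
    from order_at_zero_diff[OF order_at_zero_diff[OF 2 1] 3]
    show "order_at_zero q h"
      unfolding h_def by (simp add: algebra_simps)
  qed
  then show ?thesis
    by (simp add: h_def y_def G_def)
qed

subsection \<open>The exponential of the extension\<close>

definition phi_exp :: "'a \<Rightarrow> 'a \<Rightarrow> 'a \<Rightarrow> 'a ^ 2 \<Rightarrow> 'a ^ 2" where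
  "phi_exp \<kappa> \<Delta> \<alpha> z = vector [tau_val (exp_coeff \<kappa> \<Delta>) (z $ 1),
     tau_val (exp_coeff 1 0) (z $ 2) + tau_val (ext_coeff \<kappa> \<Delta> \<alpha>) (z $ 1)]"

lemma phi_exp_nth [simp]:
  "phi_exp \<kappa> \<Delta> \<alpha> z $ 1 = tau_val (exp_coeff \<kappa> \<Delta>) (z $ 1)"
  "phi_exp \<kappa> \<Delta> \<alpha> z $ 2 = tau_val (exp_coeff 1 0) (z $ 2) + tau_val (ext_coeff \<kappa> \<Delta> \<alpha>) (z $ 1)"
  by (simp_all add: phi_exp_def)

lemma twisted_mat_act_phi_t:
  "twisted_mat_act q (phi_t \<theta> \<kappa> \<Delta> \<alpha>) x $ 1 = \<theta> * x $ 1 + \<kappa> * (x $ 1) ^ q + \<Delta> * (x $ 1) ^ (q ^ 2)"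
  "twisted_mat_act q (phi_t \<theta> \<kappa> \<Delta> \<alpha>) x $ 2 = \<alpha> * (x $ 1) ^ q + (\<theta> * x $ 2 + (x $ 2) ^ q)"
proof -
  have "twisted_act q 0 y = 0" for y :: 'a
    by (simp add: twisted_act_def)
  then show "twisted_mat_act q (phi_t \<theta> \<kappa> \<Delta> \<alpha>) x $ 1 = \<theta> * x $ 1 + \<kappa> * (x $ 1) ^ q + \<Delta> * (x $ 1) ^ (q ^ 2)"
    by (simp add: twisted_mat_act_def phi_t_def sum_2 twisted_act_rho_t)
  have "[:0, \<alpha>:] = rho_t 0 \<alpha> 0"
    by (simp add: rho_t_def)
  then show "twisted_mat_act q (phi_t \<theta> \<kappa> \<Delta> \<alpha>) x $ 2 = \<alpha> * (x $ 1) ^ q + (\<theta> * x $ 2 + (x $ 2) ^ q)"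
    by (simp add: twisted_mat_act_def phi_t_def sum_2 twisted_act_rho_t carlitz_t_eq_rho_t)
qed

lemma phi_exp_theta: "phi_exp \<kappa> \<Delta> \<alpha> (\<theta> *s z) = twisted_mat_act q (phi_t \<theta> \<kappa> \<Delta> \<alpha>) (phi_exp \<kappa> \<Delta> \<alpha> z)"
  unfolding vec_eq_iff forall_2 twisted_mat_act_phi_t
  by (simp add: exp_val_theta carlitz_val_theta ext_val_theta frob_add distrib_left)

lemma Fq_linear_phi_exp: "Fq_linear F (phi_exp \<kappa> \<Delta> \<alpha>)"
  unfolding Fq_linear_def vec_eq_iff forall_2
  by (simp add: tau_val_add tau_val_scale entire_intros distrib_left add_ac)

section \<open>Expansion of the exponential in two variables\<close>

lemma tau_val_has_sum_fst:
  assumes "entire_coeffs c"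
  shows "((\<lambda>(m, n). (if n = 0 then fps_nth (tau_fps c) m else 0) * x ^ m * y ^ n)
    has_sum tau_val c x) UNIV"
proof -
  let ?f = "\<lambda>(m, n). (if n = 0 then fps_nth (tau_fps c) m else 0) * x ^ m * y ^ n"
    and ?h = "\<lambda>i. (q ^ i, 0 :: nat)"
  have "((\<lambda>i. c i * x ^ (q ^ i)) has_sum tau_val c x) UNIV"
    by (intro null_sums_has_sum tau_val_sums entire_coeffs_null assms)
  moreover have "inj ?h"
    by (auto simp: inj_def)
  ultimately have "(?f has_sum tau_val c x) (range ?h)"
    by (subst has_sum_reindex) (simp_all add: o_def)
  \<comment> \<open>Only the pairs (q^i, 0) carry a term, so the sum over their range extends to all
    pairs.\<close>
  moreover have "?f p = 0" if "p \<notin> range ?h" for p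
    using that tau_fps_nth_eq_0[of "fst p" c] by (cases p) auto
  ultimately show ?thesis
    by (subst has_sum_cong_neutral[of "range ?h" UNIV ?f ?f]) auto
qed

lemma tau_val_has_sum_snd:
  assumes "entire_coeffs c"
  shows "((\<lambda>(m, n). (if m = 0 then fps_nth (tau_fps c) n else 0) * x ^ m * y ^ n)
    has_sum tau_val c y) UNIV"
proof -
  have "((\<lambda>p. (\<lambda>(m, n). (if n = 0 then fps_nth (tau_fps c) m else 0) * y ^ m * x ^ n) (prod.swap p))
      has_sum tau_val c y) UNIV"
    using tau_val_has_sum_fst[OF assms, of y x]
    by (subst has_sum_reindex_bij_betw) (auto simp: bij_betw_def)
  then show ?thesis
    by (rule has_sum_cong[THEN iffD1, rotated]) auto
qed

definition phi_exp_coeff :: "'a \<Rightarrow> 'a \<Rightarrow> 'a \<Rightarrow> nat \<Rightarrow> nat \<Rightarrow> 'a ^ 2" where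
  "phi_exp_coeff \<kappa> \<Delta> \<alpha> m n = vector
     [if n = 0 then fps_nth (tau_fps (exp_coeff \<kappa> \<Delta>)) m else 0,
      (if m = 0 then fps_nth (tau_fps (exp_coeff 1 0)) n else 0) +
      (if n = 0 then fps_nth (tau_fps (ext_coeff \<kappa> \<Delta> \<alpha>)) m else 0)]"

lemma phi_exp_expansion: "has_entire_expansion (phi_exp \<kappa> \<Delta> \<alpha>) (phi_exp_coeff \<kappa> \<Delta> \<alpha>)"
  unfolding has_entire_expansion_def forall_2
proof (intro allI conjI)
  fix z :: "'a ^ 2"
  show "((\<lambda>(m, n). phi_exp_coeff \<kappa> \<Delta> \<alpha> m n $ 1 * (z $ 1) ^ m * (z $ 2) ^ n)
      has_sum phi_exp \<kappa> \<Delta> \<alpha> z $ 1) UNIV"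
    using tau_val_has_sum_fst[OF entire_exp_coeff] by (simp add: phi_exp_coeff_def)
  have "((\<lambda>p. (\<lambda>(m, n). (if m = 0 then fps_nth (tau_fps (exp_coeff 1 0)) n else 0) * (z $ 1) ^ m * (z $ 2) ^ n) p
      + (\<lambda>(m, n). (if n = 0 then fps_nth (tau_fps (ext_coeff \<kappa> \<Delta> \<alpha>)) m else 0) * (z $ 1) ^ m * (z $ 2) ^ n) p)
      has_sum phi_exp \<kappa> \<Delta> \<alpha> z $ 2) UNIV"
    unfolding phi_exp_nth
    by (intro has_sum_add tau_val_has_sum_fst tau_val_has_sum_snd entire_intros)
  then show "((\<lambda>(m, n). phi_exp_coeff \<kappa> \<Delta> \<alpha> m n $ 2 * (z $ 1) ^ m * (z $ 2) ^ n)
      has_sum phi_exp \<kappa> \<Delta> \<alpha> z $ 2) UNIV"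
    by (rule has_sum_cong[THEN iffD1, rotated]) (auto simp: phi_exp_coeff_def distrib_right)
qed

lemma phi_exp_coeff_low:
  assumes "m + n < q"
  shows "phi_exp_coeff \<kappa> \<Delta> \<alpha> m n =
    (if (m, n) = (1, 0) then axis 1 1 else if (m, n) = (0, 1) then axis 2 1 else 0)"
  using assms unfolding vec_eq_iff forall_2
  by (auto simp: phi_exp_coeff_def tau_fps_nth_less axis_def)

text \<open>Convergence at the point (1, 1) bounds all coefficients, and for M \<le> 1 every
  monomial of degree at least q is at most M^q. The constant belongs to one coordinate
  \<open>j\<close>.\<close>

lemma entire_expansion_near_0:
  fixes f :: "'a ^ 2 \<Rightarrow> 'a ^ 2"
  assumes f: "has_entire_expansion f c"
    and low: "\<And>m n. m + n < q \<Longrightarrow> c m n =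
      (if (m, n) = (1, 0) then axis 1 1 else if (m, n) = (0, 1) then axis 2 1 else 0)"
  obtains C where "0 < C" "\<And>z M. absval (z $ 1) \<le> M \<Longrightarrow> absval (z $ 2) \<le> M \<Longrightarrow> M \<le> 1 \<Longrightarrow>
    absval (f z $ j - z $ j) \<le> C * M ^ q"
proof -
  have "((\<lambda>(m, n). c m n $ j) has_sum f 1 $ j) UNIV"
    using f[unfolded has_entire_expansion_def, rule_format, of j 1] by simp
  then obtain C where C: "0 < C" "\<And>p. absval ((\<lambda>(m, n). c m n $ j) p) \<le> C"
    using has_sum_absval_bounded by blast
  have "absval (f z $ j - z $ j) \<le> C * M ^ q"
    if M: "absval (z $ 1) \<le> M" "absval (z $ 2) \<le> M" "M \<le> 1" for z :: "'a ^ 2" and M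
  proof -
    have "0 \<le> M"
      using M(1) absval_nonneg[of "z $ 1"] by linarith
    let ?a = "\<lambda>(m, n). c m n $ j * (z $ 1) ^ m * (z $ 2) ^ n"
    have "(?a has_sum f z $ j) UNIV"
      using f by (simp add: has_entire_expansion_def)
    then have "absval (f z $ j - sum ?a {(1, 0), (0, 1)}) \<le> C * M ^ q"
    proof (rule has_sum_absval_diff_le)
      fix p :: "nat \<times> nat" assume p: "p \<notin> {(1, 0), (0, 1)}"
      obtain m n where mn: "p = (m, n)" by (cases p)
      show "absval (?a p) \<le> C * M ^ q"
      proof (cases "m + n < q")
        case True
        then show ?thesis
          using p C \<open>0 \<le> M\<close> by (auto simp: mn low)
      next
        case False
        have "absval (?a p) = absval (c m n $ j) * (absval (z $ 1) ^ m * absval (z $ 2) ^ n)"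
          by (simp add: mn absval_mult absval_power mult.assoc)
        also have "\<dots> \<le> C * (M ^ m * M ^ n)"
          using C(1) C(2)[of "(m, n)"] M \<open>0 \<le> M\<close> by (intro mult_mono power_mono) auto
        also have "\<dots> \<le> C * M ^ q"
          using False M \<open>0 \<le> M\<close> C(1) by (auto simp flip: power_add intro!: mult_left_mono power_decreasing)
        finally show ?thesis .
      qed
    qed (use C \<open>0 \<le> M\<close> in auto)
    moreover have "sum ?a {(1, 0), (0, 1)} = z $ j"
      using exhaust_2[of j] q_ge_2 by (auto simp: low axis_def)
    ultimately show ?thesis by simp
  qed
  with C(1) show ?thesis by (rule that)
qed

text \<open>The larger of the two coordinates takes the place of |h|. As \<kappa>, \<Delta> and
  \<alpha> may be large, the threshold is 1 / B: below it B X^k \<le> B X^2 \<le> X for k \<ge> 2,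
  so the nonlinear terms stay below the linear one.\<close>

lemma phi_equation_unique:
  fixes d :: "'a ^ 2 \<Rightarrow> 'a ^ 2"
  assumes d: "\<And>z. d (\<theta> *s z) = twisted_mat_act q (phi_t \<theta> \<kappa> \<Delta> \<alpha>) (d z)"
    and C: "\<And>z M j. absval (z $ 1) \<le> M \<Longrightarrow> absval (z $ 2) \<le> M \<Longrightarrow> M \<le> 1 \<Longrightarrow>
      absval (d z $ j) \<le> C * M ^ q"
  shows "d z = 0"
proof -
  define w where "w n = inverse \<theta> ^ n *s z" for n
  define x where "x n = max (absval (d (w n) $ 1)) (absval (d (w n) $ 2))" for n
  define B where "B = 1 + absval \<kappa> + absval \<Delta> + absval \<alpha>"
  define M where "M = max (absval (z $ 1)) (absval (z $ 2))"
  have B: "1 \<le> B" "absval \<kappa> \<le> B" "absval \<Delta> \<le> B" "absval \<alpha> \<le> B" "absval 1 \<le> B"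
    by (auto simp: B_def)
  have "x 0 = 0"
  proof (rule expansion_null[of "real q" "1 / B"])
    fix n assume small: "x (Suc n) \<le> 1 / B"
    let ?X = "x (Suc n)" and ?y = "d (w (Suc n))"
    have X: "0 \<le> ?X" "absval (?y $ 1) \<le> ?X" "absval (?y $ 2) \<le> ?X"
      by (auto simp: x_def max_def)
    have "1 / B \<le> 1"
      using B(1) by simp
    with small have "?X \<le> 1"
      by linarith
    have term_le: "absval (b * v ^ k) \<le> real q * ?X" if "absval b \<le> B" "absval v \<le> ?X" "2 \<le> k" for b v k
    proof -
      have "absval b * absval v ^ k \<le> B * ?X ^ k"
        using that B by (intro mult_mono power_mono) auto
      also have "?X ^ k \<le> ?X ^ 2"
        using that X \<open>?X \<le> 1\<close> by (intro power_decreasing) auto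
      also have "B * ?X ^ 2 = (B * ?X) * ?X"
        by (simp add: power2_eq_square)
      also have "\<dots> \<le> 1 * ?X"
        using small B X by (intro mult_right_mono) (auto simp: field_simps)
      also have "\<dots> \<le> real q * ?X"
        using X q_ge_2 by (intro mult_right_mono) auto
      finally show ?thesis
        using B by (simp add: absval_mult absval_power mult_left_mono)
    qed
    have "2 \<le> q ^ 2"
      using q_ge_2 q_le_q_power[of 2] by linarith
    note terms = term_le[OF B(2) X(2) q_ge_2] term_le[OF B(3) X(2) \<open>2 \<le> q ^ 2\<close>]
      term_le[OF B(4) X(2) q_ge_2] term_le[OF B(5) X(3) q_ge_2, simplified]
    have lin: "absval (\<theta> * ?y $ 1) \<le> real q * ?X" "absval (\<theta> * ?y $ 2) \<le> real q * ?X"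
      using X by (auto simp: absval_mult absval_theta intro!: mult_left_mono)
    have "w n = \<theta> *s w (Suc n)"
      by (simp add: w_def vec_eq_iff)
    then have "d (w n) = twisted_mat_act q (phi_t \<theta> \<kappa> \<Delta> \<alpha>) ?y"
      by (simp add: d)
    then have "absval (d (w n) $ 1) \<le> real q * ?X" "absval (d (w n) $ 2) \<le> real q * ?X"
      by (simp_all only: twisted_mat_act_phi_t) (intro absval_add_le terms lin)+
    then show "x n \<le> real q * ?X"
      by (simp add: x_def)
  next
    have "0 \<le> M" by (simp add: M_def max_def)
    have "(\<lambda>n. M / real q ^ n) \<longlonglongrightarrow> 0"
      using tendsto_mult[OF tendsto_const LIMSEQ_inverse_realpow_zero[of "real q"], of M] q_ge_2
      by (simp add: divide_inverse)
    then have "\<forall>\<^sub>F n in sequentially. M / real q ^ n < 1"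
      by (rule order_tendstoD) simp
    then show "\<forall>\<^sub>F n in sequentially. x n \<le> (\<bar>C\<bar> * M ^ q) / (real q ^ 2) ^ n"
    proof eventually_elim
      case (elim n)
      have w: "absval (w n $ i) \<le> M / real q ^ n" for i
      proof -
        have "absval (z $ i) \<le> M"
          using exhaust_2[of i] by (auto simp: M_def)
        then have "absval (z $ i) / real q ^ n \<le> M / real q ^ n"
          by (intro divide_right_mono) auto
        moreover have "w n $ i = z $ i / \<theta> ^ n"
          by (simp add: w_def field_simps power_inverse)
        ultimately show ?thesis
          by (simp add: absval_divide absval_power absval_theta)
      qed
      have "absval (d (w n) $ j) \<le> \<bar>C\<bar> * (M ^ q / (real q ^ 2) ^ n)" for j
      proof -
        have "absval (d (w n) $ j) \<le> C * (M / real q ^ n) ^ q"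
          using elim by (intro C w) auto
        also have "\<dots> \<le> \<bar>C\<bar> * (M ^ q / (real q ^ 2) ^ n)"
          using \<open>0 \<le> M\<close> by (intro mult_mono q_powers_le) auto
        finally show ?thesis .
      qed
      then show ?case by (simp add: x_def)
    qed
  qed (use q_ge_2 B in \<open>auto simp: x_def le_max_iff_disj\<close>)
  then have "absval (d z $ 1) \<le> 0" "absval (d z $ 2) \<le> 0"
    by (simp_all add: x_def w_def max_def split: if_splits)
  then show ?thesis
    by (simp add: vec_eq_iff forall_2)
qed

text \<open>Uniqueness compares values instead of coefficients: both maps agree with the identity up
  to O(M^q), and since phi_t acts additively their difference satisfies the same equation.\<close>

lemma tmodule_exp_phi_t: "tmodule_exp q F \<theta> (phi_t \<theta> \<kappa> \<Delta> \<alpha>) = phi_exp \<kappa> \<Delta> \<alpha>"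
  unfolding tmodule_exp_def
proof (rule the_equality)
  show "Fq_linear F (phi_exp \<kappa> \<Delta> \<alpha>) \<and>
      (\<exists>c. has_entire_expansion (phi_exp \<kappa> \<Delta> \<alpha>) c \<and>
        (\<forall>m n. m + n < q \<longrightarrow> c m n =
          (if (m, n) = (1, 0) then axis 1 1 else if (m, n) = (0, 1) then axis 2 1 else 0))) \<and>
      (\<forall>z. phi_exp \<kappa> \<Delta> \<alpha> (\<theta> *s z) = twisted_mat_act q (phi_t \<theta> \<kappa> \<Delta> \<alpha>) (phi_exp \<kappa> \<Delta> \<alpha> z))"
    using Fq_linear_phi_exp phi_exp_expansion phi_exp_coeff_low phi_exp_theta by blast
next
  fix f :: "'a ^ 2 \<Rightarrow> 'a ^ 2"
  assume f: "Fq_linear F f \<and>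
      (\<exists>c. has_entire_expansion f c \<and>
        (\<forall>m n. m + n < q \<longrightarrow> c m n =
          (if (m, n) = (1, 0) then axis 1 1 else if (m, n) = (0, 1) then axis 2 1 else 0))) \<and>
      (\<forall>z. f (\<theta> *s z) = twisted_mat_act q (phi_t \<theta> \<kappa> \<Delta> \<alpha>) (f z))"
  then obtain c where c: "has_entire_expansion f c" "\<And>m n. m + n < q \<Longrightarrow> c m n =
      (if (m, n) = (1, 0) then axis 1 1 else if (m, n) = (0, 1) then axis 2 1 else 0)"
    by blast
  define g where "g = phi_exp \<kappa> \<Delta> \<alpha>"
  have near: "\<exists>C. \<forall>z M. absval (z $ 1) \<le> M \<longrightarrow> absval (z $ 2) \<le> M \<longrightarrow> M \<le> 1 \<longrightarrow>
      absval (f z $ j - g z $ j) \<le> C * M ^ q" for j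
  proof -
    obtain C1 where C1: "0 < C1" "\<And>z M. absval (z $ 1) \<le> M \<Longrightarrow> absval (z $ 2) \<le> M \<Longrightarrow> M \<le> 1 \<Longrightarrow>
        absval (f z $ j - z $ j) \<le> C1 * M ^ q"
      using entire_expansion_near_0[OF c] by blast
    obtain C2 where C2: "0 < C2" "\<And>z M. absval (z $ 1) \<le> M \<Longrightarrow> absval (z $ 2) \<le> M \<Longrightarrow> M \<le> 1 \<Longrightarrow>
        absval (g z $ j - z $ j) \<le> C2 * M ^ q"
      unfolding g_def using entire_expansion_near_0[OF phi_exp_expansion phi_exp_coeff_low] by blast
    have "absval (f z $ j - g z $ j) \<le> max C1 C2 * M ^ q"
      if M: "absval (z $ 1) \<le> M" "absval (z $ 2) \<le> M" "M \<le> 1" for z :: "'a ^ 2" and M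
    proof -
      have "0 \<le> M"
        using M(1) absval_nonneg[of "z $ 1"] by linarith
      then have "C1 * M ^ q \<le> max C1 C2 * M ^ q" "C2 * M ^ q \<le> max C1 C2 * M ^ q"
        by (auto intro!: mult_right_mono)
      with C1(2)[OF M] C2(2)[OF M]
      have "absval ((f z $ j - z $ j) - (g z $ j - z $ j)) \<le> max C1 C2 * M ^ q"
        by (intro absval_diff_le[of "f z $ j - z $ j"]) linarith+
      then show ?thesis by simp
    qed
    then show ?thesis by blast
  qed
  obtain C1 where C1: "\<And>z M. absval (z $ 1) \<le> M \<Longrightarrow> absval (z $ 2) \<le> M \<Longrightarrow> M \<le> 1 \<Longrightarrow>
      absval (f z $ 1 - g z $ 1) \<le> C1 * M ^ q"
    using near[of 1] by blast
  obtain C2 where C2: "\<And>z M. absval (z $ 1) \<le> M \<Longrightarrow> absval (z $ 2) \<le> M \<Longrightarrow> M \<le> 1 \<Longrightarrow>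
      absval (f z $ 2 - g z $ 2) \<le> C2 * M ^ q"
    using near[of 2] by blast
  have "f z - g z = 0" for z
  proof (rule phi_equation_unique[of "\<lambda>z. f z - g z"])
    fix z
    have "(x - y) ^ (q ^ 2) = x ^ (q ^ 2) - y ^ (q ^ 2)" for x y :: 'a
      by (simp add: power2_eq_square power_mult frob_diff)
    moreover have "f (\<theta> *s z) = twisted_mat_act q (phi_t \<theta> \<kappa> \<Delta> \<alpha>) (f z)"
        "g (\<theta> *s z) = twisted_mat_act q (phi_t \<theta> \<kappa> \<Delta> \<alpha>) (g z)"
      using f by (auto simp: g_def phi_exp_theta)
    ultimately show "f (\<theta> *s z) - g (\<theta> *s z) = twisted_mat_act q (phi_t \<theta> \<kappa> \<Delta> \<alpha>) (f z - g z)"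
      unfolding vec_eq_iff forall_2
      by (simp add: twisted_mat_act_phi_t frob_diff right_diff_distrib)
  next
    fix z :: "'a ^ 2" and M :: real and j :: 2
    assume M: "absval (z $ 1) \<le> M" "absval (z $ 2) \<le> M" "M \<le> 1"
    have "0 \<le> M"
      using M(1) absval_nonneg[of "z $ 1"] by linarith
    then have "C1 * M ^ q \<le> max C1 C2 * M ^ q" "C2 * M ^ q \<le> max C1 C2 * M ^ q"
      by (auto intro!: mult_right_mono)
    with C1[OF M] C2[OF M] exhaust_2[of j]
    show "absval ((f z - g z) $ j) \<le> max C1 C2 * M ^ q"
      by auto
  qed
  then show "f = phi_exp \<kappa> \<Delta> \<alpha>"
    by (auto simp: g_def)
qed

end

theorem theorem1p2:
  fixes q :: nat
    and F :: "'a::complete_alg_closed_valued_field set"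
    and \<theta> \<kappa> \<Delta> \<alpha> r \<pi> u \<omega> lam :: 'a
  assumes "C_infinity q F \<theta>"
    and "\<kappa> \<in> algebraic_over (rational_field F \<theta>)"
    and "\<Delta> \<in> algebraic_over (rational_field F \<theta>)" and "\<Delta> \<noteq> 0"
    and "r ^ (q - 1) = - \<Delta>"
    and "\<alpha> \<in> algebraic_over (rational_field F \<theta>)" and "\<alpha> \<noteq> 0"
    and "carlitz_period q F \<theta> \<pi>"
    and "drinfeld_exp q \<theta> (rho_t \<theta> \<kappa> \<Delta>) u = \<alpha> / r"
    and "tmodule_exp q F \<theta> (phi_t \<theta> \<kappa> \<Delta> \<alpha>) (vector [\<omega>, lam]) = 0"
  shows "\<exists>f\<in>polys_over F.
    lam = - r * (u * quasi_periodic_tau q \<theta> (rho_t \<theta> \<kappa> \<Delta>) \<omega>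
               - \<omega> * quasi_periodic_tau q \<theta> (rho_t \<theta> \<kappa> \<Delta>) u)
        + poly f \<theta> * \<pi>"
proof -
  interpret C_infinity q F \<theta> by fact
  let ?e = "tau_val (exp_coeff \<kappa> \<Delta>)" and ?C = "tau_val (exp_coeff 1 0)"
    and ?F = "tau_val (qp_coeff \<kappa> \<Delta>)" and ?G = "tau_val (ext_coeff \<kappa> \<Delta> \<alpha>)"
  have "q = Suc (q - 1)"
    using q_ge_2 by simp
  then have r: "r ^ q = - \<Delta> * r"
    using assms(5) by (metis mult.commute power_Suc)
  \<comment> \<open>Otherwise \<Delta> would be 0, as q - 1 is positive; this makes \<alpha> / r a
    true quotient.\<close>
  have "r \<noteq> 0"
    using assms(4,5) q_ge_2 by (auto simp: zero_power)
  then have \<alpha>: "\<alpha> = r * ?e u"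
    using assms(9) by (simp add: drinfeld_exp_rho_t)
  have \<omega>: "?e \<omega> = 0" and lam: "?C lam + ?G \<omega> = 0"
    using arg_cong[OF assms(10), of "\<lambda>v :: 'a ^ 2. v $ 1"] arg_cong[OF assms(10), of "\<lambda>v :: 'a ^ 2. v $ 2"]
    by (simp_all add: tmodule_exp_phi_t)
  \<comment> \<open>By additivity the value splits into \<open>?C lam\<close> and the pairing term;
    the latter equals \<open>?G \<omega>\<close> because \<alpha> = r e(u), and the second
    coordinate of the period relation makes the sum vanish.\<close>
  have "?C (lam + r * (u * ?F \<omega> - \<omega> * ?F u)) = 0"
    using lam carlitz_exp_of_period_pairing[OF r \<omega>, of u]
    by (simp add: tau_val_add entire_exp_coeff \<alpha>)
  then obtain f where "f \<in> polys_over F" "lam + r * (u * ?F \<omega> - \<omega> * ?F u) = poly f \<theta> * \<pi>"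
    using assms(8) unfolding carlitz_period_def carlitz_t_eq_rho_t drinfeld_exp_rho_t by blast
  then show ?thesis
    unfolding quasi_periodic_tau_rho_t by (intro bexI[of _ f]) (auto simp: algebra_simps)
qed

end
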